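(* Let $K$ be a field, $c\in K$, and let $\{r_{A,n}(x)\}$ be a sequence of Ulas' polynomials or of Turaj's polynomials over $K$ (both defined in the context). Let $L_n$ and $C_n$ be the leading coefficient and the constant term of $r_{A,n}$, let $d_n=\deg r_{A,n}$, and put $R_n=\mathrm{Res}(r_{A,n},r_{A,n-1})$. Let $n\ge 2$ for Ulas' polynomials and $n\ge d+1$ for Turaj's polynomials. Write $r_{A,n;c}(x)=r_{A,n}(x)+c\,r_{A,n-1}(x)=L_nx^{d_n}+\cdots$ and let $y_1,\dots,y_{d_n}$ be the zeros of $r_{A,n;c}(x)$. Suppose that there exist polynomials $F(x),G_{1,n}(x),G_{2,n}(x),H_{1,n}(x),H_{2,n}(x)\in K[x]$ ($F$ not depending on $n$) such that $$F(x)r_{A,n}'(x)=G_{1,n}(x)r_{A,n}(x)+G_{2,n}(x)r_{A,n-1}(x)=H_{1,n}(x)r_{A,n}(x)+H_{2,n}(x)r_{A,n+1}(x)$$ (for all indices $n$ for which the terms are defined), and assume that $F(y_t)\ne0$ for all $1\le t\le d_n$. Write $$-H_{2,n-1}(y_t)c^2+\bigl(H_{1,n-1}(y_t)-G_{1,n}(y_t)\bigr)c+G_{2,n}(y_t)=\sum_{w=0}^{e}B_{e-w,n}(c)\,y_t^{w}$$ with $B_{0,n}(c),B_{1,n}(c),\dots,B_{e,n}(c)\in K[c]$, for all $1\le t\le d_n$. Let $\xi_{A,n;c,1},\dots,\xi_{A,n;c,e}$ be the solutions $\xi$, counted with multiplicity, of $\sum_{w=0}^{e}B_{e-w,n}(c)\,\xi^{w}=0$,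 so that $\sum_{w=0}^{e}B_{e-w,n}(c)x^w=(-1)^eB_{0,n}(c)\prod_{\nu=1}^e(\xi_{A,n;c,\nu}-x)$. (1) If $\{r_{A,n}\}$ are Ulas' polynomials, then $$\mathrm{disc}(r_{A,n;c})=(-1)^{\frac{d_n(d_n+2e-1)}{2}+\sum_{u=2}^n e_A(u)}B_{0,n}(c)^{d_n}L_n^{d_n-d_{n-1}-3}\left(\prod_{u=2}^n v_{u+1}^{(u-2)k+j}L_u^{2k-l}C_u^{l}\right)R_1\prod_{\nu=1}^e r_{A,n;c}(\xi_{A,n;c,\nu})\prod_{t=1}^{d_n}\frac{1}{F(y_t)}$$ $$=(-1)^{\frac{d_n(d_n+2e-1)}{2}+\sum_{u=2}^n e_A(u)}B_{0,n}(c)^{d_n}L_n^{d_n-d_{n-1}-3}\,T_A^{(2k-l)(n-2)}q_0^{l(n-1)}q_j^{k+j-l-i}\left(\prod_{u=0}^{n-2}v_{u+2}^{uk+j}\right)\left(\prod_{s=1}^{n-1}a_{s+1,0}^{l(n-s-1)}a_{s+1,k}^{(2k-l)(n-s-1)}\right)R_1\prod_{\nu=1}^e r_{A,n;c}(\xi_{A,n;c,\nu})\prod_{t=1}^{d_n}\frac{1}{F(y_t)}.$$ Here $d_n=(n-1)k+j$; $e_A(u)=((u-2)k+j)((u-1)k+j+1+l)$; and $T_A=q_j$ if $i+l<j+k$, while $T_A=\dfrac{a_{2,k}q_j-v_2p_i}{a_{2,k}}$ if $i+l=j+k$. (2) If $\{r_{A,n}\}$ are Turaj's polynomials, then $$\mathrm{disc}(r_{A,n;c})=(-1)^{\frac{d_n(d_n+2e-1)}{2}+\sum_{s=d+1}^n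 m^{n-s}e_A(s)}B_{0,n}(c)^{d_n}L_n^{d_n-d_{n-1}-3}\left(\prod_{s=d+1}^n\left(L_{s-1}^{\gamma_A(s)}v_s^{\deg(r_{A,s-1})}C_{s-1}^{l}\right)^{m^{n-s}}\right)R_d^{m^{n-d}}\prod_{\nu=1}^e r_{A,n;c}(\xi_{A,n;c,\nu})\prod_{t=1}^{d_n}\frac{1}{F(y_t)}.$$ Here $d_n=k\sum_{s=0}^{n-d-1}m^s+i_dm^{n-d}$; $e_A(n)=(d_n+l)d_{n-1}$; and $\gamma_A(n)=d_n-m\,d_{n-2}-\deg(v_nx^l)$, that is, $\gamma_A(n)=k-l+m(i_d-i_{d-1})$ for $n=d+1$ and $\gamma_A(n)=m^{n-d-1}(k+i_d(m-1))+k-l$ for $n\ge d+2$.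
   Context: For $f=a_nx^n+\cdots+a_0$ and $g=b_mx^m+\cdots+b_0$ in $K[x]$ with roots $\alpha_1,\dots,\alpha_n$ and $\beta_1,\dots,\beta_m$ respectively, $\mathrm{Res}(f,g)=a_n^mb_m^n\prod_{i=1}^n\prod_{j=1}^m(\alpha_i-\beta_j)$ and $\mathrm{disc}(f)=a_n^{2n-2}\prod_{1\le i<j\le n}(\alpha_i-\alpha_j)^2$. Ulas' polynomials: let $A=(i,j,k,l)\in\mathbb{Z}_{\ge0}^4$ with $i\le j$ and $k\ge l$. The sequence $\{r_{A,n}\}$ over $K$ is defined by $r_{A,0}(x)=\sum_{s=0}^ip_sx^s$, $r_{A,1}(x)=\sum_{s=0}^jq_sx^s$ and $r_{A,n}(x)=f_n(x)r_{A,n-1}(x)-v_nx^lr_{A,n-2}(x)$ for $n\ge2$, where $f_n(x)=\sum_{s=0}^ka_{n,s}x^s$ and $p_s,q_s,v_n,a_{n,s}\in K$. It is assumed that $p_iq_ja_{n,k}\ne0$ for all $n\ge2$ and $a_{2,k}q_j-v_2p_i\ne0$; these conditions are understood to mean that the leading coefficients of $r_{A,n}$ (for all $n$) and of $f_n$ (for $n\ge2$) do not vanish. Turaj's polynomials: let $d\in\mathbb{Z}_{\ge0}$ and $A=(i_0,i_1,\dots,i_d,k,l,m)\in\mathbb{Z}_{\ge0}^{d+4}$ with $i_0\le i_1\le\cdots\le i_d$, $k\ge l$, $m\ne0$. The sequence $\{r_{A,n}\}$ over $K$ is defined by $r_{A,u}(x)=\sum_{s=0}^{i_u}p_{s,u}x^s$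 for $0\le u\le d$ and, for $n\ge d+1$, $$r_{A,n}(x)=g_n(x)r_{A,n-1}(x)^m+\sum_{|\alpha|<m}t_{\alpha,n}(x)\,\mathbf{r}_{A,n}^{\alpha}(x)\,r_{A,n-1}(x)+v_nx^lr_{A,n-2}(x)^m,$$ where $\alpha=(\alpha_0,\dots,\alpha_d)\in\mathbb{Z}_{\ge0}^{d+1}$, $|\alpha|=\alpha_0+\cdots+\alpha_d$, $v_n\in K$, $g_n,t_{\alpha,n}\in K[x]$, $\mathbf{r}_{A,n}^{\alpha}(x)=r_{A,n-1}(x)^{\alpha_0}r_{A,n-2}(x)^{\alpha_1}\cdots r_{A,n-d-1}(x)^{\alpha_d}$ and $g_n(x)=\sum_{s=0}^ka_{s,n}x^s$. It is assumed that $t_{\alpha,n}(0)=0$, $\deg t_{\alpha,n}<\deg g_n$, and $a_{k,n}\prod_{s=0}^dp_{i_s,s}\ne0$ for all $n$; moreover, if $i_d=i_{d-1}$ and $k=l$, then $a_{k,d+1}p_{i_d,d}^m+v_{d+1}p_{i_{d-1},d-1}^m\ne0$. These conditions are understood to mean that the leading coefficients of $g_n$ and $r_{A,n}$ do not vanish for all $n$.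
   Formalization: The exponent of L_n is corrected to d_n−d_{n−1}−2−e; the first product in (1) is corrected to factors v_u^{(u−2)k+j} L_{u−1}^{2k−l} C_{u−1}^l, with L_1 exponent k+j−l−i at u=2; Turaj's case takes d≥1, since r_{−1} and R_0 are undefined for d=0. *)

theory Defs
  imports "HOL-Algebra.Algebraic_Closure_Type" "HOL-Computational_Algebra.Polynomial"
begin

text \<open>
  HOL-Algebra reuses the names \<open>degree\<close>, \<open>coeff\<close>, \<open>lead_coeff\<close> and \<open>monom\<close>, hence the
  qualified names below. All roots are taken in the algebraic closure
  \<^typ>\<open>'a alg_closure\<close> of the base field, into which the field embeds by \<^const>\<open>to_ac\<close>.
\<close>

abbreviation ac_poly :: "'a :: field poly \<Rightarrow> 'a alg_closure poly" where
  "ac_poly \<equiv> map_poly to_ac"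

definition Res :: "'a :: field poly \<Rightarrow> 'a poly \<Rightarrow> 'a alg_closure" where
  "Res f g =
     to_ac (Polynomial.lead_coeff f) ^ Polynomial.degree g *
     to_ac (Polynomial.lead_coeff g) ^ Polynomial.degree f *
     (\<Prod>\<alpha>\<in>#proots (ac_poly f). \<Prod>\<beta>\<in>#proots (ac_poly g). \<alpha> - \<beta>)"

definition sq_diff_prod :: "'b :: comm_ring_1 list \<Rightarrow> 'b" where
  "sq_diff_prod xs = (\<Prod>(i, j)\<in>{(i, j). i < j \<and> j < length xs}. (xs ! i - xs ! j) ^ 2)"

text \<open>
  The choice of the enumeration of the roots is immaterial, see \<open>disc_eq\<close> below. The exponent
  \<open>2n - 2\<close> is an integer because it is negative for constant polynomials.
\<close>

definition disc :: "'a :: field poly \<Rightarrow> 'a alg_closure" where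
  "disc f =
     to_ac (Polynomial.lead_coeff f) powi (2 * int (Polynomial.degree f) - 2) *
     sq_diff_prod (SOME xs. mset xs = proots (ac_poly f))"

lemma sq_diff_prod_mset_cong:
  assumes "mset xs = mset ys"
  shows "sq_diff_prod xs = sq_diff_prod ys"
proof -
  obtain p where p: "bij_betw p {..<length xs} {..<length ys}"
    and nth: "\<forall>i<length xs. xs ! i = ys ! p i"
    using permutation_Ex_bij[OF assms] by blast
  have len: "length xs = length ys"
    using assms by (rule mset_eq_length)
  define S where "S = {(i, j). i < j \<and> j < length xs}"
  have fin: "finite S"
    by (rule finite_subset[of _ "{..<length xs} \<times> {..<length xs}"]) (auto simp: S_def)
  define h where "h = (\<lambda>(i, j). (min (p i) (p j), max (p i) (p j)))"
  have inj: "p i = p j \<longleftrightarrow> i = j" if "i < length xs" "j < length xs" for i j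
    using p that by (auto simp: bij_betw_def inj_on_def)
  have ran: "p i < length xs" if "i < length xs" for i
    using p that len by (auto simp: bij_betw_def)
  have h_in: "h ` S \<subseteq> S"
  proof (rule image_subsetI)
    fix x assume "x \<in> S"
    then obtain i j where x: "x = (i, j)" and ij: "i < j" "j < length xs"
      by (auto simp: S_def)
    then have "p i < length xs" "p j < length xs" "p i \<noteq> p j"
      using ran[of i] ran[of j] inj[of i j] by simp_all
    then show "h x \<in> S"
      by (simp add: x h_def S_def min_def max_def)
  qed
  have h_inj: "inj_on h S"
  proof (rule inj_onI)
    fix a b assume ab: "a \<in> S" "b \<in> S" "h a = h b"
    obtain i j i' j' where [simp]: "a = (i, j)" "b = (i', j')" by fastforce
    from ab have *: "i < j" "j < length xs" "i' < j'" "j' < length xs"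
      "min (p i) (p j) = min (p i') (p j')" "max (p i) (p j) = max (p i') (p j')"
      by (auto simp: S_def h_def)
    from *(5,6) have "p i = p i' \<and> p j = p j' \<or> p i = p j' \<and> p j = p i'"
      by linarith
    then show "a = b"
    proof
      assume "p i = p i' \<and> p j = p j'"
      then have "i = i'" "j = j'" using *(1-4) inj[of i i'] inj[of j j'] by simp_all
      then show ?thesis by simp
    next
      assume "p i = p j' \<and> p j = p i'"
      then have "i = j'" "j = i'" using *(1-4) inj[of i j'] inj[of j i'] by simp_all
      then show ?thesis using *(1,3) by simp
    qed
  qed
  have hS: "h ` S = S"
    using fin h_in h_inj by (meson endo_inj_surj)
  have "sq_diff_prod ys = (\<Prod>(i, j)\<in>h ` S. (ys ! i - ys ! j) ^ 2)"
    unfolding hS by (simp add: sq_diff_prod_def S_def len)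
  also have "\<dots> = (\<Prod>a\<in>S. case h a of (i, j) \<Rightarrow> (ys ! i - ys ! j) ^ 2)"
    using h_inj by (simp add: prod.reindex)
  also have "\<dots> = (\<Prod>(i, j)\<in>S. (xs ! i - xs ! j) ^ 2)"
    using nth by (intro prod.cong)
      (auto simp: S_def h_def min_def max_def power2_commute)
  also have "\<dots> = sq_diff_prod xs"
    by (simp add: sq_diff_prod_def S_def)
  finally show ?thesis ..
qed

lemma disc_eq:
  assumes "mset xs = proots (ac_poly f)"
  shows "disc f =
     to_ac (Polynomial.lead_coeff f) powi (2 * int (Polynomial.degree f) - 2) *
     (\<Prod>(i, j)\<in>{(i, j). i < j \<and> j < length xs}. (xs ! i - xs ! j) ^ 2)"
proof -
  have "mset (SOME xs. mset xs = proots (ac_poly f)) = mset xs"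
    unfolding assms by (rule someI[of "\<lambda>xs. mset xs = proots (ac_poly f)", OF assms])
  from sq_diff_prod_mset_cong[OF this] show ?thesis
    by (simp add: disc_def sq_diff_prod_def)
qed

definition ulas_deg :: "nat \<Rightarrow> nat \<Rightarrow> nat \<Rightarrow> nat \<Rightarrow> nat" where
  "ulas_deg i j k n = (if n = 0 then i else (n - 1) * k + j)"

text \<open>
  \<open>a n s\<close> is the coefficient $a_{n,s}$ of $x^s$ in $f_n$. The last condition says that the
  leading coefficient of each \<open>r n\<close>, that is, its coefficient at the generic degree, does not
  vanish. For \<open>n = 2\<close> and \<open>i + l = j + k\<close> this coefficient is \<open>a 2 k * q j - v 2 * p i\<close>; if
  \<open>i + l < j + k\<close>, it is \<open>a 2 k * q j\<close>, and \<open>a 2 k * q j - v 2 * p i\<close> may vanish.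
\<close>

definition ulas_seq ::
  "nat \<Rightarrow> nat \<Rightarrow> nat \<Rightarrow> nat \<Rightarrow> (nat \<Rightarrow> 'a :: field) \<Rightarrow> (nat \<Rightarrow> 'a) \<Rightarrow> (nat \<Rightarrow> nat \<Rightarrow> 'a) \<Rightarrow>
   (nat \<Rightarrow> 'a) \<Rightarrow> (nat \<Rightarrow> 'a poly) \<Rightarrow> bool" where
  "ulas_seq i j k l p q a v r \<longleftrightarrow>
     i \<le> j \<and> l \<le> k \<and>
     r 0 = (\<Sum>s\<le>i. Polynomial.monom (p s) s) \<and>
     r 1 = (\<Sum>s\<le>j. Polynomial.monom (q s) s) \<and>
     (\<forall>n\<ge>2. r n = (\<Sum>s\<le>k. Polynomial.monom (a n s) s) * r (n - 1)
                   - Polynomial.monom (v n) l * r (n - 2)) \<and>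
     p i \<noteq> 0 \<and> q j \<noteq> 0 \<and> (\<forall>n\<ge>2. a n k \<noteq> 0) \<and>
     (i + l = j + k \<longrightarrow> a 2 k * q j - v 2 * p i \<noteq> 0) \<and>
     (\<forall>n. Polynomial.coeff (r n) (ulas_deg i j k n) \<noteq> 0)"

definition turaj_deg :: "nat \<Rightarrow> (nat \<Rightarrow> nat) \<Rightarrow> nat \<Rightarrow> nat \<Rightarrow> nat \<Rightarrow> nat" where
  "turaj_deg d i k m n =
     (if n < d then i n else k * (\<Sum>s<n - d. m ^ s) + i d * m ^ (n - d))"

text \<open>Multi-indices $(\alpha_0,\dots,\alpha_d)$ with $|\alpha| < m$, as lists of length \<open>d + 1\<close>.\<close>

definition multi_indices :: "nat \<Rightarrow> nat \<Rightarrow> nat list set" where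
  "multi_indices d m = {\<alpha>. length \<alpha> = d + 1 \<and> sum_list \<alpha> < m}"

lemma finite_multi_indices: "finite (multi_indices d m)"
proof (rule finite_subset)
  show "multi_indices d m \<subseteq> {\<alpha>. set \<alpha> \<subseteq> {..m} \<and> length \<alpha> = d + 1}"
  proof
    fix \<alpha> assume "\<alpha> \<in> multi_indices d m"
    then have "length \<alpha> = d + 1" "sum_list \<alpha> < m"
      by (simp_all add: multi_indices_def)
    moreover have "x \<le> sum_list \<alpha>" if "x \<in> set \<alpha>" for x
      using that by (intro member_le_sum_list) simp_all
    ultimately show "\<alpha> \<in> {\<alpha>. set \<alpha> \<subseteq> {..m} \<and> length \<alpha> = d + 1}"
      by fastforce
  qed
  show "finite {\<alpha>. set \<alpha> \<subseteq> {..m} \<and> length \<alpha> = d + 1}"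
    by (rule finite_lists_length_eq) simp
qed

text \<open>
  \<open>p s u\<close> is $p_{s,u}$, \<open>a s n\<close> is $a_{s,n}$ and \<open>t \<alpha> n\<close> is $t_{\alpha,n}$.
  We take $d \ge 1$, as $r_{d-1}$ occurs in the recurrence for $r_{d+1}$; the case of $d = 0$ with
  an additional initial polynomial $r_{-1}$ is, after a shift of the index, a sequence with
  $d = 1$. The disjunct \<open>t \<alpha> n = 0\<close> accounts for the zero polynomial having degree $-\infty$ in
  $\deg t_{\alpha,n} < \deg g_n$, but degree \<open>0\<close> in HOL. The last condition says that the leading
  coefficient of each \<open>r n\<close>, that is, its coefficient at the generic degree, does not vanish.
\<close>

definition turaj_seq ::
  "nat \<Rightarrow> (nat \<Rightarrow> nat) \<Rightarrow> nat \<Rightarrow> nat \<Rightarrow> nat \<Rightarrow> (nat \<Rightarrow> nat \<Rightarrow> 'a :: field) \<Rightarrow> (nat \<Rightarrow> nat \<Rightarrow> 'a) \<Rightarrow>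
   (nat list \<Rightarrow> nat \<Rightarrow> 'a poly) \<Rightarrow> (nat \<Rightarrow> 'a) \<Rightarrow> (nat \<Rightarrow> 'a poly) \<Rightarrow> bool" where
  "turaj_seq d i k l m p a t v r \<longleftrightarrow>
     1 \<le> d \<and> (\<forall>u<d. i u \<le> i (u + 1)) \<and> l \<le> k \<and> m \<noteq> 0 \<and>
     (\<forall>u\<le>d. r u = (\<Sum>s\<le>i u. Polynomial.monom (p s u) s)) \<and>
     (\<forall>n\<ge>d + 1. let g = (\<Sum>s\<le>k. Polynomial.monom (a s n) s) in
        r n = g * r (n - 1) ^ m
              + (\<Sum>\<alpha>\<in>multi_indices d m.
                   t \<alpha> n * (\<Prod>s\<le>d. r (n - 1 - s) ^ (\<alpha> ! s)) * r (n - 1))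
              + Polynomial.monom (v n) l * r (n - 2) ^ m \<and>
        a k n \<noteq> 0 \<and>
        (\<forall>\<alpha>\<in>multi_indices d m. poly (t \<alpha> n) 0 = 0 \<and>
           (t \<alpha> n = 0 \<or> Polynomial.degree (t \<alpha> n) < Polynomial.degree g))) \<and>
     (\<forall>u\<le>d. p (i u) u \<noteq> 0) \<and>
     (i d = i (d - 1) \<and> k = l \<longrightarrow>
        a k (d + 1) * p (i d) d ^ m + v (d + 1) * p (i (d - 1)) (d - 1) ^ m \<noteq> 0) \<and>
     (\<forall>n. Polynomial.coeff (r n) (turaj_deg d i k m n) \<noteq> 0)"

end

theory Submission
  imports Defs
begin

text \<open>
  Write $h = r_n + c\,r_{n-1}$. Up to a sign and a power of the leading coefficient, the
  discriminant of $h$ is the product of the values $h'(y)$ over the zeros $y$ of $h$. At such a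
  zero $r_n(y) = -c\,r_{n-1}(y)$, so the two structure relations turn $F(y) h'(y)$ into
  $r_{n-1}(y) P(y)$, where $P(y)$ is the given quadratic expression in $c$. Multiplying over all
  zeros, the factors $r_{n-1}(y)$ yield the resultant of $r_n$ and $r_{n-1}$, and the factors
  $P(y)$ yield, after exchanging a double product, the values of $h$ at the zeros of $P$. This is
  \<open>disc_structure_relations\<close>; it holds for any two polynomials with structure relations.

  The families enter only through the resultants of neighbours. In both of them $r_n$ is
  congruent to $v_n x^l r_{n-2}^m$ modulo $r_{n-1}$, with $m = 1$ and $-v_n$ instead of $v_n$ for
  Ulas sequences. Since a resultant with $r_{n-1}$ only sees values at the zeros of $r_{n-1}$,
  \<open>Res_recurrence\<close> expresses the resultant of $r_n$ and $r_{n-1}$ by the $m$-th power of the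
  resultant of $r_{n-1}$ and $r_{n-2}$, and iterating this gives \<open>ulas_Res\<close> and \<open>turaj_Res\<close>. The
  exponents depend on the degrees, which are the generic ones (\<open>ulas_degree\<close>, \<open>turaj_degree\<close>).

  The second formula for Ulas sequences evaluates the leading coefficients and constant terms
  (\<open>ulas_Res_factor\<close>). If $k = 0$, the recurrence for the leading coefficients has two terms, and so
  has the one for the constant terms if $l = 0$. Then they are in general no products, but those
  that the recurrence determines occur with exponent $0$.
\<close>

section \<open>The embedding of polynomials into the algebraic closure\<close>

lemma ac_poly_add: "ac_poly (f + g) = ac_poly f + ac_poly g"
  by (rule poly_eqI) (simp add: coeff_map_poly)

lemma ac_poly_mult: "ac_poly (f * g) = ac_poly f * ac_poly g"
  by (rule poly_eqI) (simp add: coeff_map_poly coeff_mult to_ac_sum)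

lemma ac_poly_power: "ac_poly (f ^ m) = ac_poly f ^ m"
  by (induction m) (simp_all add: ac_poly_mult)

lemma ac_poly_smult: "ac_poly (Polynomial.smult c f) = Polynomial.smult (to_ac c) (ac_poly f)"
  by (rule poly_eqI) (simp add: coeff_map_poly)

lemma ac_poly_monom: "ac_poly (Polynomial.monom c l) = Polynomial.monom (to_ac c) l"
  by (simp add: map_poly_monom)

lemma ac_poly_pderiv: "ac_poly (pderiv f) = pderiv (ac_poly f)"
proof (rule poly_eqI)
  fix k
  show "Polynomial.coeff (ac_poly (pderiv f)) k = Polynomial.coeff (pderiv (ac_poly f)) k"
    by (simp add: coeff_map_poly coeff_pderiv del: of_nat_Suc)
qed

lemma degree_ac_poly [simp]: "Polynomial.degree (ac_poly f) = Polynomial.degree f"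
  by (simp add: degree_map_poly)

lemma ac_poly_eq_0_iff [simp]: "ac_poly f = 0 \<longleftrightarrow> f = 0"
  by (auto simp: poly_eq_iff coeff_map_poly)

lemma proots_split:
  fixes p :: "'b :: alg_closed_field poly"
  shows "p = Polynomial.smult (Polynomial.lead_coeff p) (\<Prod>\<alpha>\<in>#proots p. [:-\<alpha>, 1:])"
    and "size (proots p) = Polynomial.degree p"
proof -
  have "size (proots p) = Polynomial.degree p \<and>
    p = Polynomial.smult (Polynomial.lead_coeff p) (\<Prod>\<alpha>\<in>#proots p. [:-\<alpha>, 1:])"
  proof (cases "p = 0")
    case False
    then obtain A where A: "size A = Polynomial.degree p"
      "p = Polynomial.smult (Polynomial.lead_coeff p) (\<Prod>\<alpha>\<in>#A. [:-\<alpha>, 1:])"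
      using alg_closed_imp_factorization by blast
    have "proots p = proots (\<Prod>\<alpha>\<in>#A. [:-\<alpha>, 1:])"
      using False by (subst A(2)) simp
    also have "\<dots> = A"
    proof (induction A)
      case (add x A)
      have "(\<Prod>\<alpha>\<in>#A. [:-\<alpha>, 1:]) \<noteq> 0"
        by (auto simp: prod_mset_zero_iff)
      then have "proots ([:-x, 1:] * (\<Prod>\<alpha>\<in>#A. [:-\<alpha>, 1:]))
          = {#x#} + proots (\<Prod>\<alpha>\<in>#A. [:-\<alpha>, 1:])"
        by (subst proots_mult) auto
      then show ?case
        using add.IH by simp
    qed simp
    finally show ?thesis
      using A by simp
  qed simp
  then show "p = Polynomial.smult (Polynomial.lead_coeff p) (\<Prod>\<alpha>\<in>#proots p. [:-\<alpha>, 1:])"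
    and "size (proots p) = Polynomial.degree p"
    by simp_all
qed

section \<open>Zeros and resultants\<close>

abbreviation roots :: "'a :: field poly \<Rightarrow> 'a alg_closure multiset" where
  "roots f \<equiv> proots (ac_poly f)"

lemma size_roots [simp]: "size (roots f) = Polynomial.degree f"
  by (simp add: proots_split(2))

lemma poly_roots_eq_0: "\<beta> \<in># roots f \<Longrightarrow> poly (ac_poly f) \<beta> = 0"
  by (cases "f = 0") auto

lemma lead_coeff_ac_poly: "Polynomial.lead_coeff (ac_poly f) = to_ac (Polynomial.lead_coeff f)"
  by (simp add: coeff_map_poly)

lemma poly_ac_poly_eq_prod_roots:
  "poly (ac_poly f) x = to_ac (Polynomial.lead_coeff f) * (\<Prod>\<alpha>\<in>#roots f. x - \<alpha>)"
  by (subst proots_split(1)[of "ac_poly f"])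
     (simp add: lead_coeff_ac_poly poly_prod_mset image_mset.compositionality o_def del: degree_ac_poly)

lemma prod_mset_diff_commute:
  fixes A :: "'b :: comm_ring_1 multiset"
  shows "(\<Prod>\<alpha>\<in>#A. \<alpha> - x) = (-1) ^ size A * (\<Prod>\<alpha>\<in>#A. x - \<alpha>)"
  by (induction A) (auto simp: algebra_simps)

lemma prod_mset_const_mult:
  fixes z :: "'b :: comm_monoid_mult"
  shows "(\<Prod>\<alpha>\<in>#A. z * f \<alpha>) = z ^ size A * (\<Prod>\<alpha>\<in>#A. f \<alpha>)"
  by (simp add: prod_mset.distrib)

text \<open>
  The form of the resultant that makes it computable: it depends on \<open>g\<close> only through its degree and
  its values at the zeros of \<open>f\<close>, so \<open>g\<close> may be replaced by anything congruent to it modulo \<open>f\<close>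
  that has the same degree (see \<open>Res_cong_left\<close> for the mirrored statement).
\<close>
lemma Res_eq_prod_roots_left:
  "Res f g = to_ac (Polynomial.lead_coeff f) ^ Polynomial.degree g * (\<Prod>\<alpha>\<in>#roots f. poly (ac_poly g) \<alpha>)"
  by (simp add: Res_def poly_ac_poly_eq_prod_roots prod_mset_const_mult mult_ac)

lemma prod_mset_swap:
  "(\<Prod>\<alpha>\<in>#A. \<Prod>\<beta>\<in>#B. f \<alpha> \<beta>) = (\<Prod>\<beta>\<in>#B. \<Prod>\<alpha>\<in>#A. f \<alpha> \<beta>)"
  by (induction A) (simp_all add: prod_mset.distrib)

lemma Res_commute: "Res f g = (-1) ^ (Polynomial.degree f * Polynomial.degree g) * Res g f"
proof -
  have "(\<Prod>\<alpha>\<in>#roots f. \<Prod>\<beta>\<in>#roots g. \<alpha> - \<beta>) = (\<Prod>\<beta>\<in>#roots g. \<Prod>\<alpha>\<in>#roots f. \<alpha> - \<beta>)"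
    by (rule prod_mset_swap)
  also have "\<dots> = (\<Prod>\<beta>\<in>#roots g. (-1) ^ Polynomial.degree f * (\<Prod>\<alpha>\<in>#roots f. \<beta> - \<alpha>))"
    by (simp add: prod_mset_diff_commute)
  also have "\<dots> = (-1) ^ (Polynomial.degree f * Polynomial.degree g) * (\<Prod>\<beta>\<in>#roots g. \<Prod>\<alpha>\<in>#roots f. \<beta> - \<alpha>)"
    by (simp add: prod_mset_const_mult power_mult)
  finally show ?thesis
    by (simp add: Res_def mult_ac)
qed

text \<open>
  Vieta's formula for the constant term. It turns the factor \<open>x ^ l\<close> of a recurrence, evaluated at
  the zeros, into powers of the constant term and the leading coefficient.
\<close>
lemma prod_roots:
  assumes "f \<noteq> 0"
  shows "(\<Prod>\<alpha>\<in>#roots f. \<alpha>) =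
    (-1) ^ Polynomial.degree f * to_ac (Polynomial.coeff f 0) / to_ac (Polynomial.lead_coeff f)"
proof -
  have "poly (ac_poly f) 0 = to_ac (Polynomial.lead_coeff f) * ((-1) ^ Polynomial.degree f * (\<Prod>\<alpha>\<in>#roots f. \<alpha>))"
    using prod_mset_diff_commute[where x = 0 and A = "roots f"]
    by (simp add: poly_ac_poly_eq_prod_roots)
  moreover have "poly (ac_poly f) 0 = to_ac (Polynomial.coeff f 0)"
    by (simp add: poly_0_coeff_0 coeff_map_poly)
  ultimately show ?thesis
    using assms by (simp add: field_simps)
qed

lemma Res_cong_left:
  assumes "\<And>\<beta>. \<beta> \<in># roots g \<Longrightarrow> poly (ac_poly f) \<beta> = poly (ac_poly f') \<beta>"
    and "Polynomial.degree f = Polynomial.degree f'"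
  shows "Res f g = Res f' g"
proof -
  have "Res g f = Res g f'"
    unfolding Res_eq_prod_roots_left assms(2)
    using assms(1) by (intro arg_cong2[of _ _ _ _ "(*)"] arg_cong[of _ _ prod_mset] image_mset_cong) auto
  then show ?thesis
    using Res_commute[of f g] Res_commute[of f' g] assms(2) by simp
qed

text \<open>
  One step of the Euclidean algorithm for resultants. At a zero of \<open>r1\<close> the multiple of \<open>r1\<close>
  vanishes, so \<open>r2\<close> takes the value \<open>v * x ^ l * r0 x ^ m\<close>; the product of these values over the
  zeros of \<open>r1\<close> is evaluated factor by factor. The exponent of the leading coefficient collects
  \<open>degree r2\<close> from \<open>Res r1 r2\<close>, \<open>- m * degree r0\<close> from the \<open>m\<close> copies of \<open>Res r1 r0\<close>, and \<open>- l\<close> from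
  Vieta's formula; it may be negative. In the sign, \<open>degree r2 * degree r1\<close> comes from exchanging
  the arguments of the resultant and \<open>l * degree r1\<close> from Vieta's formula.
\<close>
lemma Res_recurrence:
  assumes rec: "r2 = s * r1 + Polynomial.monom v l * r0 ^ m"
    and nz: "r1 \<noteq> 0"
  shows "Res r2 r1 =
    (-1) ^ ((Polynomial.degree r2 + l) * Polynomial.degree r1)
    * (to_ac (Polynomial.lead_coeff r1)
         powi (int (Polynomial.degree r2) - int m * int (Polynomial.degree r0) - int l)
       * to_ac v ^ Polynomial.degree r1 * to_ac (Polynomial.coeff r1 0) ^ l)
    * Res r1 r0 ^ m"
proof -
  define L where "L = to_ac (Polynomial.lead_coeff r1)"
  define D where "D = Polynomial.degree r1"
  define P where "P = (\<Prod>\<beta>\<in>#roots r1. poly (ac_poly r0) \<beta>)"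
  define C where "C = to_ac (Polynomial.coeff r1 0)"
  define Q where "Q = L powi (int (Polynomial.degree r2) - int m * int (Polynomial.degree r0) - int l)"
  have L: "L \<noteq> 0"
    using nz by (simp add: L_def)
  have *: "poly (ac_poly r2) \<beta> = to_ac v * (\<beta> ^ l * poly (ac_poly r0) \<beta> ^ m)" if "\<beta> \<in># roots r1" for \<beta>
    using that nz by (simp add: rec ac_poly_add ac_poly_mult ac_poly_power ac_poly_monom poly_monom)
  have pw: "(\<Prod>\<beta>\<in>#A. f \<beta> ^ k) = (\<Prod>\<beta>\<in>#A. f \<beta>) ^ k" for A and f :: "'b \<Rightarrow> 'a alg_closure" and k
    by (induction A) (simp_all add: power_mult_distrib)
  have "(\<Prod>\<beta>\<in>#roots r1. poly (ac_poly r2) \<beta>) = (\<Prod>\<beta>\<in>#roots r1. to_ac v * (\<beta> ^ l * poly (ac_poly r0) \<beta> ^ m))"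
    using * by (intro arg_cong[of _ _ prod_mset] image_mset_cong) auto
  also have "\<dots> = to_ac v ^ D * (((-1) ^ D * C / L) ^ l * P ^ m)"
    using prod_roots[OF nz] by (simp add: prod_mset_const_mult prod_mset.distrib pw D_def P_def L_def C_def)
  finally have "Res r1 r2 = L ^ Polynomial.degree r2 * (to_ac v ^ D * (((-1) ^ D * C / L) ^ l * P ^ m))"
    by (simp add: Res_eq_prod_roots_left L_def)
  also have "((-1) ^ D * C / L) ^ l = (-1) ^ (D * l) * C ^ l / L ^ l"
    by (simp add: power_mult_distrib power_divide power_mult)
  also have "L ^ Polynomial.degree r2 = Q * L ^ (m * Polynomial.degree r0) * L ^ l"
    using L power_int_of_nat[of L "m * Polynomial.degree r0"] by (simp add: Q_def power_int_diff)
  finally have "Res r1 r2 = (-1) ^ (D * l) * (Q * to_ac v ^ D * C ^ l)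
      * (L ^ (m * Polynomial.degree r0) * P ^ m)"
    using L by (simp add: field_simps)
  moreover have "Res r1 r0 ^ m = L ^ (m * Polynomial.degree r0) * P ^ m"
    by (simp add: Res_eq_prod_roots_left L_def P_def power_mult_distrib flip: power_mult) (simp add: mult.commute)
  moreover have "(-1) ^ ((Polynomial.degree r2 + l) * D) =
      ((-1) ^ (Polynomial.degree r2 * D) * (-1) ^ (D * l) :: 'a alg_closure)"
    by (simp add: power_add[symmetric] algebra_simps)
  ultimately show ?thesis
    unfolding Res_commute[of r2 r1] L_def[symmetric]
    unfolding Q_def[symmetric] C_def[symmetric] D_def[symmetric]
    by (simp only: mult_ac)
qed

section \<open>Discriminants\<close>

text \<open>
  The ordered pairs \<open>(i, j)\<close> and \<open>(j, i)\<close> contribute the factors \<open>x - y\<close> and \<open>y - x\<close>, whose product is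
  \<open>- (x - y) ^ 2\<close>, and there are \<open>n * (n - 1) div 2\<close> such couples.
\<close>
lemma prod_diff_ne_eq_sq_diff_prod:
  fixes xs :: "'b :: comm_ring_1 list"
  defines "n \<equiv> length xs"
  shows "(\<Prod>i<n. \<Prod>j\<in>{..<n} - {i}. xs ! i - xs ! j) = (-1) ^ (n * (n - 1) div 2) * sq_diff_prod xs"
proof -
  define S where "S = {(i, j). i < j \<and> j < n}"
  define D where "D = (\<lambda>(i, j). xs ! i - xs ! j)"
  have S_Sigma: "S = (SIGMA j:{..<n}. {..<j})\<inverse>"
    by (auto simp: S_def)
  have fin: "finite S"
    unfolding S_Sigma by simp
  have sq: "sq_diff_prod xs = (\<Prod>x\<in>S. case x of (i, j) \<Rightarrow> (xs ! i - xs ! j) ^ 2)"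
    by (simp add: sq_diff_prod_def S_def n_def)
  have card: "card S = n * (n - 1) div 2"
  proof -
    have "card S = (\<Sum>j<n. j)"
      unfolding S_Sigma card_inverse by simp
    then show ?thesis
      by (cases n) (simp_all add: lessThan_Suc_atMost gauss_sum_nat atMost_atLeast0 mult.commute del: mult_Suc_right mult_Suc)
  qed
  have "(\<Prod>i<n. \<Prod>j\<in>{..<n} - {i}. xs ! i - xs ! j) = prod D (SIGMA i:{..<n}. {..<n} - {i})"
    by (simp add: D_def prod.Sigma)
  \<comment> \<open>The off-diagonal pairs are those above the diagonal and their mirror images.\<close>
  also have "(SIGMA i:{..<n}. {..<n} - {i}) = S \<union> prod.swap ` S"
    by (force simp: S_def)
  also have "prod D \<dots> = prod D S * prod D (prod.swap ` S)"
    using fin by (intro prod.union_disjoint) (auto simp: S_def)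
  also have "prod D (prod.swap ` S) = prod (D \<circ> prod.swap) S"
    by (rule prod.reindex) simp
  also have "prod D S * \<dots> = (\<Prod>x\<in>S. - 1 * (case x of (i, j) \<Rightarrow> (xs ! i - xs ! j) ^ 2))"
    by (subst prod.distrib[symmetric]) (auto simp: D_def power2_eq_square algebra_simps intro!: prod.cong)
  also have "\<dots> = (-1) ^ (n * (n - 1) div 2) * sq_diff_prod xs"
    by (simp only: prod.distrib prod_constant card sq)
  finally show ?thesis .
qed

text \<open>
  By the product rule, the derivative of $L \prod_j (x - x_j)$ at the zero $x_i$ is
  $L \prod_{j \ne i} (x_i - x_j)$. So the product of these values contains \<open>L\<close> to the power
  \<open>N\<close>, which leaves \<open>N - 2\<close> of the exponent \<open>2 * N - 2\<close> in the discriminant.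
\<close>
lemma disc_eq_prod_pderiv:
  assumes nz: "f \<noteq> 0"
  defines "N \<equiv> Polynomial.degree f"
  shows "disc f = (-1) ^ (N * (N - 1) div 2) * to_ac (Polynomial.lead_coeff f) powi (int N - 2)
    * (\<Prod>\<alpha>\<in>#roots f. poly (ac_poly (pderiv f)) \<alpha>)"
proof -
  obtain xs where xs: "mset xs = roots f"
    using ex_mset by blast
  have len: "length xs = N"
    using arg_cong[OF xs, of size] by (simp add: N_def)
  define L where "L = to_ac (Polynomial.lead_coeff f)"
  have L: "L \<noteq> 0"
    using nz by (simp add: L_def)
  have prod_mset_xs: "(\<Prod>\<alpha>\<in>#roots f. h \<alpha>) = (\<Prod>i<N. h (xs ! i))" for h :: "_ \<Rightarrow> 'b :: comm_monoid_mult"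
  proof -
    have "(\<Prod>\<alpha>\<in>#roots f. h \<alpha>) = prod_list (map h xs)"
      by (simp add: xs[symmetric] prod_mset_prod_list[symmetric])
    also have "\<dots> = (\<Prod>i<N. h (xs ! i))"
      by (simp add: prod.list_conv_set_nth len lessThan_atLeast0)
    finally show ?thesis .
  qed
  have "ac_poly f = Polynomial.smult L (\<Prod>i<N. [:- (xs ! i), 1:])"
    using proots_split(1)[of "ac_poly f"] by (simp add: prod_mset_xs L_def lead_coeff_ac_poly del: degree_ac_poly)
  then have pd: "pderiv (ac_poly f) =
      Polynomial.smult L (\<Sum>i<N. \<Prod>j\<in>{..<N} - {i}. [:- (xs ! j), 1:])"
    by (simp add: pderiv_smult pderiv_prod pderiv_pCons)
  have "poly (pderiv (ac_poly f)) (xs ! i) = L * (\<Prod>j\<in>{..<N} - {i}. xs ! i - xs ! j)" if "i < N" for i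
  proof -
    have "(\<Sum>i'<N. \<Prod>j\<in>{..<N} - {i'}. xs ! i - xs ! j) = (\<Prod>j\<in>{..<N} - {i}. xs ! i - xs ! j)"
    proof (rule sum.remove[THEN trans])
      have "(\<Prod>j\<in>{..<N} - {i'}. xs ! i - xs ! j) = 0" if "i' \<noteq> i" for i'
        using that \<open>i < N\<close> by (intro prod_zero) auto
      then have "(\<Sum>i'\<in>{..<N} - {i}. \<Prod>j\<in>{..<N} - {i'}. xs ! i - xs ! j) = 0"
        by (intro sum.neutral) blast
      then show "(\<Prod>j\<in>{..<N} - {i}. xs ! i - xs ! j)
          + (\<Sum>i'\<in>{..<N} - {i}. \<Prod>j\<in>{..<N} - {i'}. xs ! i - xs ! j)
          = (\<Prod>j\<in>{..<N} - {i}. xs ! i - xs ! j)"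
        by simp
    qed (use \<open>i < N\<close> in auto)
    then show ?thesis
      by (simp add: pd poly_sum poly_prod)
  qed
  then have "(\<Prod>\<alpha>\<in>#roots f. poly (ac_poly (pderiv f)) \<alpha>) = L ^ N * ((-1) ^ (N * (N - 1) div 2) * sq_diff_prod xs)"
    using prod_diff_ne_eq_sq_diff_prod[of xs]
    by (simp add: prod_mset_xs ac_poly_pderiv len prod.distrib)
  moreover have "disc f = L powi (2 * int N - 2) * sq_diff_prod xs"
    using disc_eq[OF xs] by (simp add: sq_diff_prod_def L_def N_def)
  moreover have "L powi (2 * int N - 2) = L powi (int N - 2) * L ^ N"
    using L power_int_add[of L "int N - 2" "int N"] by simp
  moreover have "(-1 :: 'a alg_closure) ^ (N * (N - 1) div 2) * (-1) ^ (N * (N - 1) div 2) = 1"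
    by (simp flip: power_mult_distrib)
  ultimately show ?thesis
    by (simp add: L_def[symmetric])
qed

text \<open>
  The discriminant is a product of values of \<open>h'\<close> at the zeros \<open>y\<close> of \<open>h\<close>. There \<open>f y = - c * g y\<close>, so
  the two structure relations, in which only \<open>f\<close> and \<open>g\<close> occur, combine to
  \<open>F y * h' y = g y * P y\<close>. The product over all \<open>y\<close> splits accordingly.
  The product of the \<open>g y\<close> is, up to \<open>L ^ degree g\<close>, the resultant of \<open>h\<close> and \<open>g\<close>, and this equals
  \<open>Res f g\<close> because \<open>h\<close> and \<open>f\<close> agree at the zeros of \<open>g\<close> and have the same degree. The product of
  the \<open>P y\<close> is a double product of differences \<open>\<xi> - y\<close>, and exchanging the two products gives the
  values of \<open>h\<close> at the zeros of \<open>P\<close>, each divided by \<open>L\<close>. So the exponent of \<open>L\<close> is \<open>N - 2\<close>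
  (discriminant) minus \<open>degree g\<close> (resultant) minus \<open>e\<close> (zeros of \<open>P\<close>).
\<close>
lemma disc_structure_relations:
  fixes f g :: "'a :: field poly" and P :: "'a alg_closure poly"
  assumes nz: "f \<noteq> 0"
    and h: "h = f + Polynomial.smult c g"
    and h_deg: "Polynomial.degree h = Polynomial.degree f"
    and h_lead: "Polynomial.lead_coeff h = Polynomial.lead_coeff f"
    and f': "F * pderiv f = G1 * f + G2 * g"
    and g': "F * pderiv g = H1 * g + H2 * f"
    and F_nz: "\<And>y. y \<in># roots h \<Longrightarrow> poly (ac_poly F) y \<noteq> 0"
    and P: "\<And>y. y \<in># roots h \<Longrightarrow>
      - poly (ac_poly H2) y * to_ac c ^ 2 + (poly (ac_poly H1) y - poly (ac_poly G1) y) * to_ac c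
        + poly (ac_poly G2) y = poly P y"
    and P_split: "P = Polynomial.smult ((-1) ^ e * b) (\<Prod>\<nu>=1..e. [:\<xi> \<nu>, -1:])"
  defines "N \<equiv> Polynomial.degree f"
  shows "disc h = (-1) ^ (N * (N + 2 * e - 1) div 2) * b ^ N
    * to_ac (Polynomial.lead_coeff f) powi (int N - int (Polynomial.degree g) - 2 - int e)
    * Res f g * ((\<Prod>\<nu>=1..e. poly (ac_poly h) (\<xi> \<nu>)) * (\<Prod>y\<in>#roots h. 1 / poly (ac_poly F) y))"
proof -
  define L where "L = to_ac (Polynomial.lead_coeff f)"
  have L: "L \<noteq> 0"
    using nz by (simp add: L_def)
  have h_nz: "h \<noteq> 0"
    using h_lead nz by auto
  have poly_h: "poly (ac_poly h) x = L * (\<Prod>y\<in>#roots h. x - y)" for x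
    by (simp add: poly_ac_poly_eq_prod_roots h_lead L_def)
  have "poly (ac_poly (pderiv h)) y = poly (ac_poly g) y * poly P y * (1 / poly (ac_poly F) y)"
    if y: "y \<in># roots h" for y
  proof -
    have "F * pderiv h = G1 * f + G2 * g + Polynomial.smult c (H1 * g + H2 * f)"
      by (simp add: h pderiv_add pderiv_smult f'[symmetric] g'[symmetric] algebra_simps)
    then have "poly (ac_poly (F * pderiv h)) y =
        poly (ac_poly (G1 * f + G2 * g + Polynomial.smult c (H1 * g + H2 * f))) y"
      by simp
    then have "poly (ac_poly F) y * poly (ac_poly (pderiv h)) y =
        poly (ac_poly G1) y * poly (ac_poly f) y + poly (ac_poly G2) y * poly (ac_poly g) y
        + to_ac c * (poly (ac_poly H1) y * poly (ac_poly g) y + poly (ac_poly H2) y * poly (ac_poly f) y)"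
      by (simp add: ac_poly_add ac_poly_mult ac_poly_smult)
    moreover have "poly (ac_poly f) y = - to_ac c * poly (ac_poly g) y"
      using poly_roots_eq_0[OF y] by (simp add: h ac_poly_add ac_poly_smult eq_neg_iff_add_eq_0)
    ultimately have "poly (ac_poly F) y * poly (ac_poly (pderiv h)) y = poly (ac_poly g) y * poly P y"
      unfolding P[OF y, symmetric] by (simp add: algebra_simps power2_eq_square)
    then show ?thesis
      using F_nz[OF y] by (simp add: field_simps)
  qed
  then have deriv: "(\<Prod>y\<in>#roots h. poly (ac_poly (pderiv h)) y) =
      (\<Prod>y\<in>#roots h. poly (ac_poly g) y) * (\<Prod>y\<in>#roots h. poly P y)
      * (\<Prod>y\<in>#roots h. 1 / poly (ac_poly F) y)"
    by (subst prod_mset.distrib[symmetric])+ (auto intro!: arg_cong[of _ _ prod_mset] image_mset_cong)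
  have Res: "Res f g = L ^ Polynomial.degree g * (\<Prod>y\<in>#roots h. poly (ac_poly g) y)"
  proof -
    have "Res f g = Res h g"
      by (rule Res_cong_left)
         (simp_all add: h_deg, simp add: h ac_poly_add ac_poly_smult poly_roots_eq_0)
    then show ?thesis
      by (simp add: Res_eq_prod_roots_left h_lead L_def)
  qed
  have prodP: "L ^ e * (\<Prod>y\<in>#roots h. poly P y) =
      (-1) ^ (e * N) * b ^ N * (\<Prod>\<nu>=1..e. poly (ac_poly h) (\<xi> \<nu>))"
  proof -
    have "(\<Prod>y\<in>#roots h. poly P y) =
        ((-1) ^ e * b) ^ N * (\<Prod>y\<in>#roots h. \<Prod>\<nu>=1..e. \<xi> \<nu> - y)"
      by (simp add: P_split poly_prod prod_mset_const_mult h_deg N_def)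
    also have "(\<Prod>y\<in>#roots h. \<Prod>\<nu>=1..e. \<xi> \<nu> - y) = (\<Prod>\<nu>=1..e. \<Prod>y\<in>#roots h. \<xi> \<nu> - y)"
      unfolding prod_unfold_prod_mset by (rule prod_mset_swap)
    finally show ?thesis
      by (simp add: poly_h prod.distrib power_mult_distrib power_mult)
  qed
  \<comment> \<open>The sign \<open>(-1) ^ (e * N)\<close> stems from the factors \<open>(-1) ^ e\<close> of the \<open>N\<close> values of \<open>P\<close>.\<close>
  have sgn: "N * (N - 1) div 2 + e * N = N * (N + 2 * e - 1) div 2"
  proof -
    have "N * (N + 2 * e - 1) = N * (N - 1) + e * N * 2"
      by (cases N) (simp_all add: algebra_simps)
    then show ?thesis by simp
  qed
  have "L powi (int N - 2) =
      L powi (int N - int (Polynomial.degree g) - 2 - int e) * L ^ Polynomial.degree g * L ^ e"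
    using L by (simp add: power_int_diff)
  then have "disc h = (-1) ^ (N * (N - 1) div 2)
      * (L powi (int N - int (Polynomial.degree g) - 2 - int e) * L ^ Polynomial.degree g * L ^ e)
      * ((\<Prod>y\<in>#roots h. poly (ac_poly g) y) * (\<Prod>y\<in>#roots h. poly P y)
      * (\<Prod>y\<in>#roots h. 1 / poly (ac_poly F) y))"
    using disc_eq_prod_pderiv[OF h_nz] unfolding h_lead L_def[symmetric]
    unfolding h_deg N_def[symmetric] deriv by simp
  also have "\<dots> = (-1) ^ (N * (N - 1) div 2)
      * L powi (int N - int (Polynomial.degree g) - 2 - int e)
      * (L ^ Polynomial.degree g * (\<Prod>y\<in>#roots h. poly (ac_poly g) y))
      * (L ^ e * (\<Prod>y\<in>#roots h. poly P y)) * (\<Prod>y\<in>#roots h. 1 / poly (ac_poly F) y)"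
    by (simp only: mult_ac)
  finally show ?thesis
    unfolding prodP Res[symmetric] sgn[symmetric] power_add L_def[symmetric]
    by (simp only: mult_ac)
qed

section \<open>Iterated recurrences and coefficients\<close>

lemma iterate_power_recurrence:
  fixes R Y :: "nat \<Rightarrow> 'b :: comm_semiring_1"
  assumes "d \<le> n"
    and "\<And>s. d < s \<Longrightarrow> R s = Y s * R (s - 1) ^ m"
  shows "R n = (\<Prod>s=d + 1..n. Y s ^ (m ^ (n - s))) * R d ^ (m ^ (n - d))"
  using assms(1)
proof (induction n rule: dec_induct)
  case (step n)
  have "(\<Prod>s=d + 1..n. Y s ^ (m ^ (Suc n - s))) = (\<Prod>s=d + 1..n. Y s ^ (m ^ (n - s))) ^ m"
    unfolding prod_power_distrib
    by (intro prod.cong) (auto simp: Suc_diff_le power_mult[symmetric] mult.commute)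
  moreover have "R d ^ (m ^ (Suc n - d)) = (R d ^ (m ^ (n - d))) ^ m"
    using step.hyps by (simp add: Suc_diff_le power_mult[symmetric] mult.commute)
  ultimately show ?case
    using step assms(2)[of "Suc n"] by (simp add: power_mult_distrib mult_ac)
qed simp

lemma prod_sign_split:
  fixes Y :: "nat \<Rightarrow> 'b :: comm_ring_1"
  shows "(\<Prod>s\<in>A. ((-1) ^ f s * Y s) ^ h s) = (-1) ^ (\<Sum>s\<in>A. h s * f s) * (\<Prod>s\<in>A. Y s ^ h s)"
  by (simp add: power_mult_distrib prod.distrib power_sum power_mult[symmetric] mult.commute)

lemma coeff_sum_monom:
  "Polynomial.coeff (\<Sum>s\<le>k. Polynomial.monom (c s) s) u = (if u \<le> k then c u else 0)"
  by (simp add: coeff_sum)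

lemma degree_sum_monom_le: "Polynomial.degree (\<Sum>s\<le>k. Polynomial.monom (c s) s) \<le> k"
  by (rule degree_le) (simp add: coeff_sum_monom)

lemma degree_mult_le_add:
  assumes "Polynomial.degree f \<le> a" "Polynomial.degree g \<le> b"
  shows "Polynomial.degree (f * g) \<le> a + b"
  using degree_mult_le[of f g] assms by linarith

lemma degree_power_le_mult:
  assumes "Polynomial.degree f \<le> a"
  shows "Polynomial.degree (f ^ m) \<le> m * a"
  using degree_power_le[of f m] mult_le_mono2[OF assms, of m] by (metis le_trans mult.commute)

section \<open>Ulas sequences\<close>

lemma ulas_seqD:
  assumes "ulas_seq i j k l p q a v r"
  shows "i \<le> j" "l \<le> k" "r 0 = (\<Sum>s\<le>i. Polynomial.monom (p s) s)"
    "r 1 = (\<Sum>s\<le>j. Polynomial.monom (q s) s)"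
    "n \<ge> 2 \<Longrightarrow> r n = (\<Sum>s\<le>k. Polynomial.monom (a n s) s) * r (n - 1)
                   - Polynomial.monom (v n) l * r (n - 2)"
    "q j \<noteq> 0" "n \<ge> 2 \<Longrightarrow> a n k \<noteq> 0"
    "Polynomial.coeff (r n) (ulas_deg i j k n) \<noteq> 0"
  using assms by (simp_all add: ulas_seq_def)

lemma ulas_deg_step:
  assumes "n \<ge> 2"
  shows "k + ulas_deg i j k (n - 1) = ulas_deg i j k n"
proof -
  obtain w where "n = 2 + w"
    using assms le_Suc_ex by blast
  then show ?thesis
    by (simp add: ulas_deg_def)
qed

text \<open>
  The recurrence bounds the degree by the generic one, because \<open>i \<le> j\<close> and \<open>l \<le> k\<close>; the coefficient
  at the generic degree is nonzero by definition.
\<close>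
lemma ulas_degree:
  assumes U: "ulas_seq i j k l p q a v r"
  shows "Polynomial.degree (r n) = ulas_deg i j k n"
proof (rule antisym)
  show "ulas_deg i j k n \<le> Polynomial.degree (r n)"
    using ulas_seqD(8)[OF U] by (rule le_degree)
  show "Polynomial.degree (r n) \<le> ulas_deg i j k n"
  proof (induction n rule: less_induct)
    case (less n)
    consider "n = 0" | "n = 1" | "n \<ge> 2" by linarith
    then show ?case
    proof cases
      assume n: "n \<ge> 2"
      have "k + ulas_deg i j k (n - 1) = ulas_deg i j k n"
        by (rule ulas_deg_step[OF n])
      moreover have "l + ulas_deg i j k (n - 2) \<le> ulas_deg i j k n"
      proof -
        obtain w where "n = w + 2" using n le_Suc_ex[of 2 n] by auto
        then show ?thesis
          using ulas_seqD(1,2)[OF U] by (cases w) (auto simp: ulas_deg_def)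
      qed
      moreover have "Polynomial.degree ((\<Sum>s\<le>k. Polynomial.monom (a n s) s) * r (n - 1)) \<le> k + ulas_deg i j k (n - 1)"
        using n less by (intro degree_mult_le_add degree_sum_monom_le) auto
      moreover have "Polynomial.degree (Polynomial.monom (v n) l * r (n - 2)) \<le> l + ulas_deg i j k (n - 2)"
        using n less by (intro degree_mult_le_add degree_monom_le) auto
      ultimately show ?thesis
        using ulas_seqD(5)[OF U n] by (auto intro: degree_diff_le)
    qed (use ulas_seqD(3,4)[OF U] degree_sum_monom_le in \<open>simp_all add: ulas_deg_def\<close>)
  qed
qed

lemma ulas_nonzero:
  assumes "ulas_seq i j k l p q a v r"
  shows "r n \<noteq> 0"
  using ulas_seqD(8)[OF assms, of n] by auto

lemma ulas_lead_coeff_recurrence: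
  assumes U: "ulas_seq i j k l p q a v r" and n: "n \<ge> 2"
  shows "Polynomial.lead_coeff (r n) = a n k * Polynomial.lead_coeff (r (n - 1))
    - Polynomial.coeff (Polynomial.monom (v n) l * r (n - 2)) (k + ulas_deg i j k (n - 1))"
proof -
  have deg: "Polynomial.degree (\<Sum>s\<le>k. Polynomial.monom (a n s) s) = k"
    using ulas_seqD(7)[OF U n] by (intro antisym degree_sum_monom_le le_degree) (simp add: coeff_sum_monom)
  have "Polynomial.lead_coeff (r n) = Polynomial.coeff (r n) (k + ulas_deg i j k (n - 1))"
    by (simp only: ulas_degree[OF U] ulas_deg_step[OF n])
  also have "\<dots> = Polynomial.coeff ((\<Sum>s\<le>k. Polynomial.monom (a n s) s) * r (n - 1)) (k + ulas_deg i j k (n - 1))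
      - Polynomial.coeff (Polynomial.monom (v n) l * r (n - 2)) (k + ulas_deg i j k (n - 1))"
    by (simp only: ulas_seqD(5)[OF U n] coeff_diff)
  finally show ?thesis
    using coeff_mult_degree_sum[of "\<Sum>s\<le>k. Polynomial.monom (a n s) s" "r (n - 1)"]
    unfolding deg by (simp add: ulas_degree[OF U] coeff_sum_monom)
qed

lemma ulas_lead_coeff_2:
  assumes U: "ulas_seq i j k l p q a v r"
  shows "Polynomial.lead_coeff (r 2) = a 2 k * q j - (if i + l < j + k then 0 else v 2 * p i)"
proof -
  have "Polynomial.coeff (Polynomial.monom (v 2) l * r 0) (k + j) = (if i + l < j + k then 0 else v 2 * p i)"
  proof (cases "i + l < j + k")
    case True
    then have "Polynomial.degree (Polynomial.monom (v 2) l * r 0) < k + j"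
      using degree_mult_le_add[OF degree_monom_le[of "v 2" l], where g = "r 0" and b = i]
      by (simp add: ulas_degree[OF U] ulas_deg_def)
    then show ?thesis using True by (simp add: coeff_eq_0)
  next
    case False
    then have "k + j = l + i" using ulas_seqD(1,2)[OF U] by linarith
    then show ?thesis
      using False ulas_seqD(3)[OF U] by (simp add: coeff_monom_mult coeff_sum_monom)
  qed
  moreover have "Polynomial.lead_coeff (r 1) = q j"
    using ulas_seqD(4)[OF U] ulas_degree[OF U, of 1] by (simp add: ulas_deg_def coeff_sum_monom)
  moreover have "k + ulas_deg i j k 1 = k + j"
    by (simp add: ulas_deg_def)
  moreover have "Polynomial.lead_coeff (r 2) = a 2 k * Polynomial.lead_coeff (r 1)
      - Polynomial.coeff (Polynomial.monom (v 2) l * r 0) (k + ulas_deg i j k 1)"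
    using ulas_lead_coeff_recurrence[OF U, of 2] by simp
  ultimately show ?thesis
    by (simp only:)
qed

text \<open>
  If \<open>k > 0\<close>, the term \<open>v n * x ^ l * r (n - 2)\<close> can reach the top degree for \<open>n = 2\<close> only, and then only
  if \<open>i + l = j + k\<close>; the factor in front of the product records this correction.
\<close>
lemma ulas_lead_coeff:
  assumes U: "ulas_seq i j k l p q a v r" and k: "k > 0" and u: "u \<ge> 2"
  shows "Polynomial.lead_coeff (r u) =
    (if i + l < j + k then q j else (a 2 k * q j - v 2 * p i) / a 2 k) * (\<Prod>s=2..u. a s k)"
  using u
proof (induction u rule: dec_induct)
  case base
  show ?case
    using ulas_seqD(7)[OF U, of 2] by (simp add: ulas_lead_coeff_2[OF U])
next
  case (step u)
  obtain w where w: "u = w + 2"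
    using step.hyps le_Suc_ex[of 2 u] by auto
  have "l + ulas_deg i j k w' < k + ulas_deg i j k u" if "w' = u - 1" for w'
    using ulas_seqD(1,2)[OF U] k that by (simp add: ulas_deg_def w)
  then have "Polynomial.degree (Polynomial.monom (v (Suc u)) l * r (u - 1)) < k + ulas_deg i j k u"
    using degree_mult_le_add[OF degree_monom_le[of "v (Suc u)" l] order.refl, where g = "r (u - 1)"]
    by (simp add: ulas_degree[OF U])
  then have "Polynomial.lead_coeff (r (Suc u)) = a (Suc u) k * Polynomial.lead_coeff (r u)"
    using ulas_lead_coeff_recurrence[OF U, of "Suc u"] step.hyps by (simp add: coeff_eq_0 numeral_2_eq_2)
  also note step.IH
  finally show ?case
    using step.hyps by (simp add: mult_ac)
qed

text \<open>
  If \<open>k = 0\<close>, then also \<open>l = 0\<close>, the second term of the recurrence can contribute for every \<open>n > 2\<close>, and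
  the leading coefficient itself is in general not the stated product. But only the power with exponent
  \<open>2 * k - l\<close> enters the resultant, and that is then \<open>1\<close>.
\<close>
lemma ulas_lead_coeff_power:
  assumes U: "ulas_seq i j k l p q a v r" and u: "u \<ge> 2"
  shows "Polynomial.lead_coeff (r u) ^ (2 * k - l) =
    ((if i + l < j + k then q j else (a 2 k * q j - v 2 * p i) / a 2 k) * (\<Prod>s=2..u. a s k)) ^ (2 * k - l)"
proof (cases "k = 0")
  case True
  then have "2 * k - l = 0" by simp
  then show ?thesis by (simp only: power_0)
next
  case False
  then show ?thesis by (simp only: ulas_lead_coeff[OF U _ u] neq0_conv)
qed

text \<open>
  If \<open>l > 0\<close>, then \<open>v n * x ^ l * r (n - 2)\<close> has no constant term. If \<open>l = 0\<close>, the constant term is in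
  general not the stated product, but its power with exponent \<open>l\<close> is \<open>1\<close>.
\<close>
lemma ulas_const_coeff_power:
  assumes U: "ulas_seq i j k l p q a v r" and u: "u \<ge> 1"
  shows "Polynomial.coeff (r u) 0 ^ l = (q 0 * (\<Prod>s=2..u. a s 0)) ^ l"
proof (cases "l = 0")
  case False
  have "Polynomial.coeff (r u) 0 = q 0 * (\<Prod>s=2..u. a s 0)"
    using u
  proof (induction u rule: dec_induct)
    case base
    show ?case using ulas_seqD(4)[OF U] by (simp add: coeff_sum_monom)
  next
    case (step u)
    have "Polynomial.coeff (r (Suc u)) 0 = a (Suc u) 0 * Polynomial.coeff (r u) 0"
      using ulas_seqD(5)[OF U, of "Suc u"] step.hyps False
      by (simp add: coeff_mult_0 coeff_sum_monom)
    then show ?case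
      using step by (simp add: mult.commute mult.left_commute)
  qed
  then show ?thesis by simp
qed simp

text \<open>
  The factor \<open>b (s + 1)\<close> occurs in the partial products for \<open>u = s + 1, \<dots>, N\<close>, hence \<open>N - s\<close> times.
\<close>
lemma prod_partial_products:
  fixes b :: "nat \<Rightarrow> 'b :: comm_semiring_1"
  shows "(\<Prod>u=1..N. (\<Prod>s=2..u. b s) ^ E) = (\<Prod>s=1..N. b (s + 1) ^ (E * (N - s)))"
proof (induction N)
  case (Suc N)
  have "(\<Prod>s=2..Suc N. b s) ^ E = (\<Prod>s=1..N. b (s + 1)) ^ E"
    using prod.shift_bounds_cl_Suc_ivl[of b 1 N] by (simp add: numeral_2_eq_2)
  also have "\<dots> = (\<Prod>s=1..N. b (s + 1) ^ E)"
    by (simp add: prod_power_distrib)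
  finally have "(\<Prod>u=1..Suc N. (\<Prod>s=2..u. b s) ^ E) = (\<Prod>s=1..N. b (s + 1) ^ (E * (N - s)) * b (s + 1) ^ E)"
    using Suc by (simp add: prod.distrib)
  also have "\<dots> = (\<Prod>s=1..N. b (s + 1) ^ (E * (Suc N - s)))"
    by (intro prod.cong) (auto simp: power_add[symmetric] Suc_diff_le add.commute)
  finally show ?case by simp
qed simp

text \<open>
  The factor \<open>u = 2\<close> stands apart: its exponent involves the degree \<open>i\<close> of \<open>r 0\<close>, and the leading
  coefficient \<open>q j\<close> of \<open>r 1\<close> does not contain \<open>T\<close>. So \<open>T\<close> occurs in the remaining \<open>n - 2\<close> factors only.
\<close>
lemma ulas_prod_lead_coeff:
  assumes U: "ulas_seq i j k l p q a v r" and n: "n \<ge> 2"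
  defines "T \<equiv> (if i + l < j + k then q j else (a 2 k * q j - v 2 * p i) / a 2 k)"
  shows "(\<Prod>u=2..n. Polynomial.lead_coeff (r (u - 1)) ^ (if u = 2 then k + j - l - i else 2 * k - l)) =
    T ^ ((2 * k - l) * (n - 2)) * q j ^ (k + j - l - i)
    * (\<Prod>s=1..n - 1. a (s + 1) k ^ ((2 * k - l) * (n - s - 1)))"
proof -
  obtain w where w: "n = Suc (Suc w)"
    using n by (metis add_2_eq_Suc le_Suc_ex)
  define E where "E = 2 * k - l"
  define \<pi> where "\<pi> = (\<lambda>u. \<Prod>s=2..u. a s k)"
  have L1: "Polynomial.lead_coeff (r 1) = q j"
    using ulas_seqD(4)[OF U] ulas_degree[OF U, of 1] by (simp add: ulas_deg_def coeff_sum_monom)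
  have shift: "(\<Prod>u=2..n. h (u - 1)) = h 1 * (\<Prod>u=2..Suc w. h u)" for h :: "nat \<Rightarrow> 'a"
  proof -
    have "(\<Prod>u=2..n. h (u - 1)) = (\<Prod>u=1..Suc w. h u)"
      using prod.shift_bounds_cl_Suc_ivl[of "\<lambda>u. h (u - 1)" 1 "Suc w"] by (simp add: w numeral_2_eq_2)
    also have "\<dots> = h 1 * (\<Prod>u=2..Suc w. h u)"
      by (subst prod.atLeast_Suc_atMost) (simp_all add: numeral_2_eq_2)
    finally show ?thesis .
  qed
  have "(\<Prod>u=2..n. Polynomial.lead_coeff (r (u - 1)) ^ (if u = 2 then k + j - l - i else 2 * k - l))
      = (\<Prod>u=2..n. (\<lambda>u. Polynomial.lead_coeff (r u) ^ (if u = 1 then k + j - l - i else E)) (u - 1))"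
    by (intro prod.cong) (auto simp: E_def)
  also have "\<dots> = q j ^ (k + j - l - i) * (\<Prod>u=2..Suc w. Polynomial.lead_coeff (r u) ^ (if u = 1 then k + j - l - i else E))"
    by (subst shift) (use L1 in simp)
  also have "(\<Prod>u=2..Suc w. Polynomial.lead_coeff (r u) ^ (if u = 1 then k + j - l - i else E))
      = (\<Prod>u=2..Suc w. T ^ E * \<pi> u ^ E)"
    using ulas_lead_coeff_power[OF U]
    by (intro prod.cong) (auto simp: E_def T_def \<pi>_def power_mult_distrib)
  also have "\<dots> = T ^ (E * w) * (\<Prod>u=2..Suc w. \<pi> u ^ E)"
    by (simp add: prod.distrib power_mult)
  also have "(\<Prod>u=2..Suc w. \<pi> u ^ E) = (\<Prod>u=1..Suc w. \<pi> u ^ E)"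
    by (subst (2) prod.atLeast_Suc_atMost) (simp_all add: \<pi>_def numeral_2_eq_2)
  also have "\<dots> = (\<Prod>s=1..n - 1. a (s + 1) k ^ (E * (n - s - 1)))"
    unfolding \<pi>_def prod_partial_products by (intro prod.cong) (auto simp: w)
  finally show ?thesis
    by (simp add: E_def w mult_ac)
qed

lemma ulas_prod_const_coeff:
  assumes U: "ulas_seq i j k l p q a v r" and n: "n \<ge> 2"
  shows "(\<Prod>u=2..n. Polynomial.coeff (r (u - 1)) 0 ^ l) =
    q 0 ^ (l * (n - 1)) * (\<Prod>s=1..n - 1. a (s + 1) 0 ^ (l * (n - s - 1)))"
proof -
  obtain w where w: "n = Suc w"
    using n by (cases n) auto
  have "(\<Prod>u=2..n. Polynomial.coeff (r (u - 1)) 0 ^ l) = (\<Prod>u=1..w. Polynomial.coeff (r u) 0 ^ l)"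
    using prod.shift_bounds_cl_Suc_ivl[of "\<lambda>u. Polynomial.coeff (r (u - 1)) 0 ^ l" 1 w]
    by (simp add: w numeral_2_eq_2)
  also have "\<dots> = (\<Prod>u=1..w. q 0 ^ l * (\<Prod>s=2..u. a s 0) ^ l)"
    using ulas_const_coeff_power[OF U] by (intro prod.cong) (auto simp: power_mult_distrib)
  also have "\<dots> = q 0 ^ (l * w) * (\<Prod>s=1..w. a (s + 1) 0 ^ (l * (w - s)))"
    by (simp only: prod.distrib prod_partial_products) (simp add: power_mult)
  finally show ?thesis
    by (simp add: w)
qed

lemma ulas_Res_factor:
  assumes U: "ulas_seq i j k l p q a v r" and n: "n \<ge> 2"
  shows "(\<Prod>u=2..n. to_ac (v u) ^ ((u - 2) * k + j)
        * to_ac (Polynomial.lead_coeff (r (u - 1))) ^ (if u = 2 then k + j - l - i else 2 * k - l)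
        * to_ac (Polynomial.coeff (r (u - 1)) 0) ^ l) =
    to_ac (if i + l < j + k then q j else (a 2 k * q j - v 2 * p i) / a 2 k) ^ ((2 * k - l) * (n - 2))
    * to_ac (q 0) ^ (l * (n - 1)) * to_ac (q j) ^ (k + j - l - i)
    * (\<Prod>u=0..n - 2. to_ac (v (u + 2)) ^ (u * k + j))
    * (\<Prod>s=1..n - 1. to_ac (a (s + 1) 0) ^ (l * (n - s - 1))
         * to_ac (a (s + 1) k) ^ ((2 * k - l) * (n - s - 1)))"
proof -
  have v: "(\<Prod>u=2..n. to_ac (v u) ^ ((u - 2) * k + j)) = (\<Prod>u=0..n - 2. to_ac (v (u + 2)) ^ (u * k + j))"
    using prod.shift_bounds_cl_nat_ivl[of "\<lambda>u. to_ac (v u) ^ ((u - 2) * k + j)" 0 2 "n - 2"]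
    by (simp only: add_0 le_add_diff_inverse2[OF n] add_diff_cancel_right')
  note lead = arg_cong[OF ulas_prod_lead_coeff[OF U n], of to_ac, unfolded to_ac_prod to_ac_mult to_ac_power]
  note const = arg_cong[OF ulas_prod_const_coeff[OF U n], of to_ac, unfolded to_ac_prod to_ac_mult to_ac_power]
  show ?thesis
    unfolding prod.distrib v lead const by (simp only: mult_ac)
qed

text \<open>
  The recurrence has the shape required by \<open>Res_recurrence\<close> with \<open>m = 1\<close> and \<open>- v u\<close> in place of \<open>v\<close>.
  The power of \<open>-1\<close> that \<open>- v u\<close> produces is the summand \<open>1\<close> in the second factor of the exponent.
\<close>
lemma ulas_Res:
  assumes U: "ulas_seq i j k l p q a v r" and n: "n \<ge> 2"
  shows "Res (r n) (r (n - 1)) =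
    (-1) ^ (\<Sum>u=2..n. ((u - 2) * k + j) * ((u - 1) * k + j + 1 + l))
    * (\<Prod>u=2..n. to_ac (v u) ^ ((u - 2) * k + j)
        * to_ac (Polynomial.lead_coeff (r (u - 1))) ^ (if u = 2 then k + j - l - i else 2 * k - l)
        * to_ac (Polynomial.coeff (r (u - 1)) 0) ^ l)
    * Res (r 1) (r 0)"
proof -
  define eA where "eA = (\<lambda>u. ((u - 2) * k + j) * ((u - 1) * k + j + 1 + l))"
  define Y where "Y = (\<lambda>u. to_ac (v u) ^ ((u - 2) * k + j)
        * to_ac (Polynomial.lead_coeff (r (u - 1))) ^ (if u = 2 then k + j - l - i else 2 * k - l)
        * to_ac (Polynomial.coeff (r (u - 1)) 0) ^ l)"
  have step: "Res (r u) (r (u - 1)) = (-1) ^ eA u * Y u * Res (r (u - 1)) (r (u - 1 - 1)) ^ 1" if u: "1 < u" for u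
  proof -
    obtain w where w: "u = Suc (Suc w)"
      using u by (metis One_nat_def less_imp_Suc_add add_Suc_right plus_1_eq_Suc add.commute)
    have deg: "Polynomial.degree (r u) = Suc w * k + j" "Polynomial.degree (r (u - 1)) = w * k + j"
      "Polynomial.degree (r (u - 2)) = (if w = 0 then i else (w - 1) * k + j)"
      by (simp_all add: ulas_degree[OF U] ulas_deg_def w)
    have ex: "int (Polynomial.degree (r u)) - int 1 * int (Polynomial.degree (r (u - 2))) - int l =
        int (if u = 2 then k + j - l - i else 2 * k - l)"
      unfolding deg using ulas_seqD(1,2)[OF U] by (cases w) (auto simp: w of_nat_diff algebra_simps)
    have "r u = (\<Sum>s\<le>k. Polynomial.monom (a u s) s) * r (u - 1) + Polynomial.monom (- v u) l * r (u - 2) ^ 1"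
      using ulas_seqD(5)[OF U, of u] u by (simp add: minus_monom[symmetric])
    from Res_recurrence[OF this ulas_nonzero[OF U]]
    have "Res (r u) (r (u - 1)) = (-1) ^ ((Suc w * k + j + l) * (w * k + j)) *
        (to_ac (Polynomial.lead_coeff (r (u - 1))) ^ (if u = 2 then k + j - l - i else 2 * k - l)
         * to_ac (- v u) ^ (w * k + j) * to_ac (Polynomial.coeff (r (u - 1)) 0) ^ l)
        * Res (r (u - 1)) (r (u - 2)) ^ 1"
      unfolding ex power_int_of_nat unfolding deg .
    moreover have "to_ac (- v u) ^ (w * k + j) = (-1) ^ (w * k + j) * to_ac (v u) ^ (w * k + j)"
      by (subst to_ac_minus) (rule power_minus)
    moreover have "(-1) ^ eA u = ((-1) ^ ((Suc w * k + j + l) * (w * k + j)) * (-1) ^ (w * k + j) :: 'a alg_closure)"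
      unfolding power_add[symmetric]
      by (intro arg_cong[of _ _ "power (-1)"]) (simp add: eA_def w algebra_simps)
    ultimately show ?thesis
      by (simp add: Y_def w mult_ac)
  qed
  have "Res (r n) (r (n - 1)) =
      (\<Prod>s=1 + 1..n. ((-1) ^ eA s * Y s) ^ (1 ^ (n - s))) * Res (r 1) (r (1 - 1)) ^ (1 ^ (n - 1))"
    using n step by (intro iterate_power_recurrence[of 1 n "\<lambda>n. Res (r n) (r (n - 1))"]) auto
  also have "(\<Prod>s=1 + 1..n. ((-1) ^ eA s * Y s) ^ (1 ^ (n - s))) = (-1) ^ (\<Sum>s=2..n. eA s) * (\<Prod>s=2..n. Y s)"
    using prod_sign_split[of eA Y "\<lambda>_. 1" "{2..n}"] by (simp add: numeral_2_eq_2)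
  finally show ?thesis
    by (simp add: eA_def Y_def)
qed

section \<open>Turaj sequences\<close>

lemma turaj_seqD:
  assumes "turaj_seq d i k l m p a t v r"
  shows "1 \<le> d" "u < d \<Longrightarrow> i u \<le> i (u + 1)" "l \<le> k" "m > 0"
    "u \<le> d \<Longrightarrow> r u = (\<Sum>s\<le>i u. Polynomial.monom (p s u) s)"
    "n \<ge> d + 1 \<Longrightarrow> r n = (\<Sum>s\<le>k. Polynomial.monom (a s n) s) * r (n - 1) ^ m
              + (\<Sum>\<alpha>\<in>multi_indices d m.
                   t \<alpha> n * (\<Prod>s\<le>d. r (n - 1 - s) ^ (\<alpha> ! s)) * r (n - 1))
              + Polynomial.monom (v n) l * r (n - 2) ^ m"
    "n \<ge> d + 1 \<Longrightarrow> \<alpha> \<in> multi_indices d m \<Longrightarrow> t \<alpha> n = 0 \<or>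
       Polynomial.degree (t \<alpha> n) < Polynomial.degree (\<Sum>s\<le>k. Polynomial.monom (a s n) s)"
    "Polynomial.coeff (r n) (turaj_deg d i k m n) \<noteq> 0"
  using assms by (simp_all add: turaj_seq_def Let_def)

lemma turaj_deg_step:
  assumes "d \<le> n"
  shows "turaj_deg d i k m (Suc n) = k + m * turaj_deg d i k m n"
proof -
  have "(\<Sum>s<Suc N. m ^ s) = 1 + m * (\<Sum>s<N. m ^ s)" for N
    by (subst sum.lessThan_Suc_shift) (simp add: sum_distrib_left)
  then show ?thesis
    using assms by (simp add: turaj_deg_def Suc_diff_le algebra_simps del: sum.lessThan_Suc)
qed

lemma turaj_deg_mono:
  assumes T: "turaj_seq d i k l m p a t v r" and "u \<le> w"
  shows "turaj_deg d i k m u \<le> turaj_deg d i k m w"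
proof (rule lift_Suc_mono_le[OF _ \<open>u \<le> w\<close>])
  fix n
  show "turaj_deg d i k m n \<le> turaj_deg d i k m (Suc n)"
  proof (cases "n < d")
    case True
    then show ?thesis
      using turaj_seqD(2)[OF T True] by (cases "Suc n = d") (auto simp: turaj_deg_def)
  next
    case False
    have "turaj_deg d i k m n \<le> m * turaj_deg d i k m n"
      using turaj_seqD(4)[OF T] by (cases m) simp_all
    then show ?thesis
      using False turaj_deg_step[of d n i k m] by linarith
  qed
qed

lemma sum_list_eq_sum_nth:
  assumes "length \<alpha> = d + 1"
  shows "sum_list \<alpha> = (\<Sum>s\<le>d. \<alpha> ! s)"
  using assms by (simp add: sum_list_sum_nth atLeast0LessThan lessThan_Suc_atMost)

text \<open>
  A term of the sum over the multi-indices contains at most \<open>m - 1\<close> factors \<open>r (n - 1 - s)\<close>, each of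
  degree at most that of \<open>r (n - 1)\<close>, one further factor \<open>r (n - 1)\<close>, and \<open>t \<alpha> n\<close> of degree at most \<open>k\<close>;
  so it does not exceed the degree \<open>k + m * degree (r (n - 1))\<close> of the first term. As for Ulas
  sequences, the generic degree is attained by definition.
\<close>
lemma turaj_degree:
  assumes T: "turaj_seq d i k l m p a t v r"
  shows "Polynomial.degree (r n) = turaj_deg d i k m n"
proof (rule antisym)
  show "turaj_deg d i k m n \<le> Polynomial.degree (r n)"
    using turaj_seqD(8)[OF T] by (rule le_degree)
  show "Polynomial.degree (r n) \<le> turaj_deg d i k m n"
  proof (induction n rule: less_induct)
    case (less n)
    show ?case
    proof (cases "n \<le> d")
      case True
      then have "turaj_deg d i k m n = i n"
        by (auto simp: turaj_deg_def)
      then show ?thesis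
        using turaj_seqD(5)[OF T True] degree_sum_monom_le by simp
    next
      case False
      then have n: "n \<ge> d + 1" by simp
      define D where "D = turaj_deg d i k m (n - 1)"
      have step: "turaj_deg d i k m n = k + m * D"
        using turaj_deg_step[of d "n - 1" i k m] n by (simp add: D_def)
      have prev: "Polynomial.degree (r (n - 1 - s)) \<le> D" for s
      proof -
        have "Polynomial.degree (r (n - 1 - s)) \<le> turaj_deg d i k m (n - 1 - s)"
          using n by (intro less) auto
        also have "\<dots> \<le> D"
          unfolding D_def by (rule turaj_deg_mono[OF T]) simp
        finally show ?thesis .
      qed
      have deg1: "Polynomial.degree (r (n - 1)) \<le> D" and deg2: "Polynomial.degree (r (n - 2)) \<le> D"
        using prev[of 0] prev[of 1] by (simp_all add: numeral_2_eq_2)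
      have "Polynomial.degree (t \<alpha> n * (\<Prod>s\<le>d. r (n - 1 - s) ^ (\<alpha> ! s)) * r (n - 1)) \<le> k + m * D"
        if \<alpha>: "\<alpha> \<in> multi_indices d m" for \<alpha>
      proof (cases "t \<alpha> n = 0")
        case False
        have "Polynomial.degree (t \<alpha> n) \<le> k"
          using turaj_seqD(7)[OF T n \<alpha>] False degree_sum_monom_le[of "\<lambda>s. a s n" k] by linarith
        moreover have "Polynomial.degree (\<Prod>s\<le>d. r (n - 1 - s) ^ (\<alpha> ! s)) \<le> (\<Sum>s\<le>d. \<alpha> ! s * D)"
          by (rule order.trans[OF degree_prod_sum_le])
             (simp, unfold o_def, intro sum_mono degree_power_le_mult prev)
        ultimately have "Polynomial.degree (t \<alpha> n * (\<Prod>s\<le>d. r (n - 1 - s) ^ (\<alpha> ! s)) * r (n - 1))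
            \<le> k + (\<Sum>s\<le>d. \<alpha> ! s * D) + D"
          using deg1 by (intro degree_mult_le_add)
        also have "\<dots> = k + (sum_list \<alpha> + 1) * D"
          using \<alpha> by (simp add: multi_indices_def sum_list_eq_sum_nth sum_distrib_right)
        also have "\<dots> \<le> k + m * D"
          using \<alpha> by (intro add_left_mono mult_right_mono) (auto simp: multi_indices_def)
        finally show ?thesis .
      qed simp
      then have "Polynomial.degree (\<Sum>\<alpha>\<in>multi_indices d m.
          t \<alpha> n * (\<Prod>s\<le>d. r (n - 1 - s) ^ (\<alpha> ! s)) * r (n - 1)) \<le> k + m * D"
        by (intro degree_sum_le finite_multi_indices)
      moreover have "Polynomial.degree ((\<Sum>s\<le>k. Polynomial.monom (a s n) s) * r (n - 1) ^ m) \<le> k + m * D"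
        by (intro degree_mult_le_add degree_sum_monom_le degree_power_le_mult deg1)
      moreover have "Polynomial.degree (Polynomial.monom (v n) l * r (n - 2) ^ m) \<le> k + m * D"
        by (intro degree_mult_le_add degree_power_le_mult deg2 order.trans[OF degree_monom_le]
              turaj_seqD(3)[OF T])
      ultimately show ?thesis
        unfolding turaj_seqD(6)[OF T n] step by (intro degree_add_le)
    qed
  qed
qed

lemma turaj_nonzero:
  assumes "turaj_seq d i k l m p a t v r"
  shows "r n \<noteq> 0"
  using turaj_seqD(8)[OF assms, of n] by auto

text \<open>
  All terms of the recurrence but the last are multiples of \<open>r (n - 1)\<close>, for the first one because
  \<open>m > 0\<close>.
\<close>
lemma turaj_recurrence_mod:
  assumes T: "turaj_seq d i k l m p a t v r" and n: "n \<ge> d + 1"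
  shows "\<exists>s. r n = s * r (n - 1) + Polynomial.monom (v n) l * r (n - 2) ^ m"
proof -
  have "r (n - 1) ^ m = r (n - 1) ^ (m - 1) * r (n - 1)"
    using turaj_seqD(4)[OF T] power_minus_mult[of m "r (n - 1)"] by simp
  then show ?thesis
    using turaj_seqD(6)[OF T n]
    by (intro exI[of _ "(\<Sum>s\<le>k. Polynomial.monom (a s n) s) * r (n - 1) ^ (m - 1)
        + (\<Sum>\<alpha>\<in>multi_indices d m. t \<alpha> n * (\<Prod>s\<le>d. r (n - 1 - s) ^ (\<alpha> ! s)))"])
       (simp add: distrib_right sum_distrib_right mult.assoc)
qed

text \<open>
  The resultant of one step enters the next one to the power \<open>m\<close>, so the factor from step \<open>s\<close>,
  including its sign, is raised to the power \<open>m ^ (n - s)\<close> after \<open>n - s\<close> further steps.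
\<close>
lemma turaj_Res:
  assumes T: "turaj_seq d i k l m p a t v r" and n: "n \<ge> d"
  defines "dg \<equiv> \<lambda>u. Polynomial.degree (r u)"
  shows "Res (r n) (r (n - 1)) =
    (-1) ^ (\<Sum>s=d + 1..n. m ^ (n - s) * ((dg s + l) * dg (s - 1)))
    * (\<Prod>s=d + 1..n. (to_ac (Polynomial.lead_coeff (r (s - 1)))
            powi (int (dg s) - int m * int (dg (s - 2)) - int l)
          * to_ac (v s) ^ dg (s - 1) * to_ac (Polynomial.coeff (r (s - 1)) 0) ^ l) ^ (m ^ (n - s)))
    * Res (r d) (r (d - 1)) ^ (m ^ (n - d))"
proof -
  define eA where "eA = (\<lambda>s. (dg s + l) * dg (s - 1))"
  define Y where "Y = (\<lambda>s. to_ac (Polynomial.lead_coeff (r (s - 1)))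
            powi (int (dg s) - int m * int (dg (s - 2)) - int l)
          * to_ac (v s) ^ dg (s - 1) * to_ac (Polynomial.coeff (r (s - 1)) 0) ^ l)"
  have "Res (r s) (r (s - 1)) = (-1) ^ eA s * Y s * Res (r (s - 1)) (r (s - 1 - 1)) ^ m" if s: "d < s" for s
  proof -
    obtain h where "r s = h * r (s - 1) + Polynomial.monom (v s) l * r (s - 2) ^ m"
      using turaj_recurrence_mod[OF T, of s] s by auto
    from Res_recurrence[OF this turaj_nonzero[OF T]] show ?thesis
      by (simp only: eA_def Y_def dg_def diff_diff_left one_add_one)
  qed
  then have "Res (r n) (r (n - 1)) =
      (\<Prod>s=d + 1..n. ((-1) ^ eA s * Y s) ^ (m ^ (n - s))) * Res (r d) (r (d - 1)) ^ (m ^ (n - d))"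
    using n by (intro iterate_power_recurrence[of d n "\<lambda>n. Res (r n) (r (n - 1))"]) auto
  then show ?thesis
    by (simp only: prod_sign_split) (simp only: eA_def Y_def)
qed

text \<open>
  The exponent of the leading coefficient in one step of \<open>turaj_Res\<close>. The step \<open>d + 1\<close> differs, since
  \<open>r (d - 1)\<close> is one of the initial polynomials, whose degree is a parameter of its own; its
  index is written \<open>d + 1 - 2\<close> to keep both statements instances of one expression in \<open>s\<close>.
\<close>
lemma turaj_degree_gap:
  assumes T: "turaj_seq d i k l m p a t v r"
  defines "dg \<equiv> \<lambda>u. Polynomial.degree (r u)"
  shows "int (dg (d + 1)) - int m * int (dg (d + 1 - 2)) - int l =
      int k - int l + int m * (int (i d) - int (i (d - 1)))"
    and "s \<ge> d + 2 \<Longrightarrow> int (dg s) - int m * int (dg (s - 2)) - int l =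
      int m ^ (s - d - 1) * (int k + int (i d) * (int m - 1)) + int k - int l"
proof -
  show "int (dg (d + 1)) - int m * int (dg (d + 1 - 2)) - int l =
      int k - int l + int m * (int (i d) - int (i (d - 1)))"
    using turaj_seqD(1)[OF T]
    by (simp add: dg_def turaj_degree[OF T] turaj_deg_def algebra_simps)
  assume s: "s \<ge> d + 2"
  obtain w where w: "s = d + 2 + w"
    using s le_Suc_ex by blast
  have "int (dg s) = int k + int m * int (dg (d + w + 1))"
    using turaj_deg_step[of d "d + w + 1" i k m] by (simp add: dg_def turaj_degree[OF T] w)
  moreover have "int (dg (d + w + 1)) = int (dg (d + w)) + int m ^ w * (int k + int (i d) * (int m - 1))"
    by (simp add: dg_def turaj_degree[OF T] turaj_deg_def algebra_simps)
  ultimately have "int (dg s) = int k + int m * (int (dg (d + w)) + int m ^ w * (int k + int (i d) * (int m - 1)))"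
    by (simp only:)
  then show "int (dg s) - int m * int (dg (s - 2)) - int l =
      int m ^ (s - d - 1) * (int k + int (i d) * (int m - 1)) + int k - int l"
    by (simp add: w algebra_simps)
qed

section \<open>The discriminant of a linear combination of two consecutive polynomials\<close>

theorem theorem4p1:
  fixes r :: "nat \<Rightarrow> 'a :: field poly"
    and c :: 'a
    and F :: "'a poly"
    and G1 G2 H1 H2 :: "nat \<Rightarrow> 'a poly"
    and B :: "nat \<Rightarrow> 'a poly"
    and n e :: nat
    and y \<xi> :: "nat \<Rightarrow> 'a alg_closure"
    and rc :: "'a poly"
  assumes rc: "rc = r n + Polynomial.smult c (r (n - 1))"
    and rc_deg: "Polynomial.degree rc = Polynomial.degree (r n)"
    and rc_lead: "Polynomial.lead_coeff rc = Polynomial.lead_coeff (r n)"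
    and zeros: "image_mset y (mset_set {1..Polynomial.degree (r n)}) = proots (ac_poly rc)"
    and G: "\<forall>u\<ge>1. F * pderiv (r u) = G1 u * r u + G2 u * r (u - 1)"
    and H: "\<forall>u\<ge>1. F * pderiv (r u) = H1 u * r u + H2 u * r (u + 1)"
    and F_nz: "\<forall>t\<in>{1..Polynomial.degree (r n)}. poly (ac_poly F) (y t) \<noteq> 0"
    and B: "\<forall>t\<in>{1..Polynomial.degree (r n)}.
        - poly (ac_poly (H2 (n - 1))) (y t) * to_ac c ^ 2
        + (poly (ac_poly (H1 (n - 1))) (y t) - poly (ac_poly (G1 n)) (y t)) * to_ac c
        + poly (ac_poly (G2 n)) (y t)
        = (\<Sum>w\<le>e. to_ac (poly (B (e - w)) c) * y t ^ w)"
    and \<xi>: "(\<Sum>w\<le>e. Polynomial.monom (to_ac (poly (B (e - w)) c)) w)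
        = Polynomial.smult ((-1) ^ e * to_ac (poly (B 0) c)) (\<Prod>\<nu>=1..e. [:\<xi> \<nu>, -1:])"
  shows "let L = (\<lambda>u. to_ac (Polynomial.lead_coeff (r u)));
             C = (\<lambda>u. to_ac (Polynomial.coeff (r u) 0));
             dg = (\<lambda>u. Polynomial.degree (r u));
             R = (\<lambda>u. Res (r u) (r (u - 1)));
             B0 = to_ac (poly (B 0) c);
             rest = (\<Prod>\<nu>=1..e. poly (ac_poly rc) (\<xi> \<nu>))
                    * (\<Prod>t=1..dg n. 1 / poly (ac_poly F) (y t))
         in
           (\<forall>i j k l p q a v. ulas_seq i j k l p q a v r \<and> n \<ge> 2 \<longrightarrow>
              (let eA = (\<lambda>u. ((u - 2) * k + j) * ((u - 1) * k + j + 1 + l));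
                   sgn = (-1) ^ (dg n * (dg n + 2 * e - 1) div 2 + (\<Sum>u=2..n. eA u));
                   T = (if i + l < j + k then q j else (a 2 k * q j - v 2 * p i) / a 2 k)
               in
                 (\<forall>u\<ge>1. dg u = (u - 1) * k + j) \<and>
                 disc rc =
                   sgn * B0 ^ dg n
                   * L n powi (int (dg n) - int (dg (n - 1)) - 2 - int e)
                   * (\<Prod>u=2..n. to_ac (v u) ^ ((u - 2) * k + j)
                        * L (u - 1) ^ (if u = 2 then k + j - l - i else 2 * k - l)
                        * C (u - 1) ^ l)
                   * R 1 * rest \<and>
                 disc rc =
                   sgn * B0 ^ dg n
                   * L n powi (int (dg n) - int (dg (n - 1)) - 2 - int e)
                   * to_ac T ^ ((2 * k - l) * (n - 2))
                   * to_ac (q 0) ^ (l * (n - 1))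
                   * to_ac (q j) ^ (k + j - l - i)
                   * (\<Prod>u=0..n - 2. to_ac (v (u + 2)) ^ (u * k + j))
                   * (\<Prod>s=1..n - 1. to_ac (a (s + 1) 0) ^ (l * (n - s - 1))
                        * to_ac (a (s + 1) k) ^ ((2 * k - l) * (n - s - 1)))
                   * R 1 * rest)) \<and>
           (\<forall>d i k l m p a t v. turaj_seq d i k l m p a t v r \<and> n \<ge> d + 1 \<longrightarrow>
              (let eA = (\<lambda>s. (dg s + l) * dg (s - 1));
                   \<gamma> = (\<lambda>s. int (dg s) - int m * int (dg (s - 2)) - int l)
               in
                 (\<forall>u\<ge>d. dg u = k * (\<Sum>s<u - d. m ^ s) + i d * m ^ (u - d)) \<and>
                 \<gamma> (d + 1) = int k - int l + int m * (int (i d) - int (i (d - 1))) \<and>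
                 (\<forall>s\<ge>d + 2. \<gamma> s = int m ^ (s - d - 1) * (int k + int (i d) * (int m - 1))
                                     + int k - int l) \<and>
                 disc rc =
                   (-1) ^ (dg n * (dg n + 2 * e - 1) div 2 + (\<Sum>s=d + 1..n. m ^ (n - s) * eA s))
                   * B0 ^ dg n
                   * L n powi (int (dg n) - int (dg (n - 1)) - 2 - int e)
                   * (\<Prod>s=d + 1..n. (L (s - 1) powi \<gamma> s * to_ac (v s) ^ dg (s - 1)
                        * C (s - 1) ^ l) ^ (m ^ (n - s)))
                   * R d ^ (m ^ (n - d)) * rest))"
proof -
  define L where "L = (\<lambda>u. to_ac (Polynomial.lead_coeff (r u)))"
  define C where "C = (\<lambda>u. to_ac (Polynomial.coeff (r u) 0))"
  define dg where "dg = (\<lambda>u. Polynomial.degree (r u))"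
  define B0 where "B0 = to_ac (poly (B 0) c)"
  define rest where "rest = (\<Prod>\<nu>=1..e. poly (ac_poly rc) (\<xi> \<nu>)) * (\<Prod>t=1..dg n. 1 / poly (ac_poly F) (y t))"
  define P where "P = (\<Sum>w\<le>e. Polynomial.monom (to_ac (poly (B (e - w)) c)) w)"
  have roots: "roots rc = image_mset y (mset_set {1..dg n})"
    using zeros by (simp add: dg_def)
  have disc: "disc rc = (-1) ^ (dg n * (dg n + 2 * e - 1) div 2) * B0 ^ dg n
      * L n powi (int (dg n) - int (dg (n - 1)) - 2 - int e) * Res (r n) (r (n - 1)) * rest"
    if "r n \<noteq> 0" "n \<ge> 2"
  proof -
    have Gn: "F * pderiv (r n) = G1 n * r n + G2 n * r (n - 1)"
      using G that by simp
    \<comment> \<open>As \<open>n \<ge> 2\<close>, the second relation is available at \<open>n - 1\<close>, where it leads up to \<open>r n\<close>.\<close>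
    have Hn: "F * pderiv (r (n - 1)) = H1 (n - 1) * r (n - 1) + H2 (n - 1) * r n"
      using H[rule_format, of "n - 1"] that by simp
    have F_roots: "poly (ac_poly F) x \<noteq> 0" if "x \<in># roots rc" for x
      using that F_nz by (auto simp: roots dg_def)
    have P_roots: "- poly (ac_poly (H2 (n - 1))) x * to_ac c ^ 2
        + (poly (ac_poly (H1 (n - 1))) x - poly (ac_poly (G1 n)) x) * to_ac c
        + poly (ac_poly (G2 n)) x = poly P x" if "x \<in># roots rc" for x
    proof -
      from that obtain t where "t \<in> {1..Polynomial.degree (r n)}" "x = y t"
        by (auto simp: roots dg_def)
      then show ?thesis
        using B by (simp add: P_def poly_sum poly_monom)
    qed
    have P_split: "P = Polynomial.smult ((-1) ^ e * B0) (\<Prod>\<nu>=1..e. [:\<xi> \<nu>, -1:])"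
      unfolding P_def B0_def by (rule \<xi>)
    have "(\<Prod>x\<in>#roots rc. 1 / poly (ac_poly F) x) = (\<Prod>t=1..dg n. 1 / poly (ac_poly F) (y t))"
      by (simp add: roots prod_unfold_prod_mset image_mset.compositionality o_def)
    then show ?thesis
      using disc_structure_relations[OF \<open>r n \<noteq> 0\<close> rc rc_deg rc_lead Gn Hn F_roots P_roots P_split]
      by (simp only: L_def dg_def rest_def)
  qed
  have disc_by_Res: "disc rc = (-1) ^ (dg n * (dg n + 2 * e - 1) div 2 + s) * B0 ^ dg n
      * L n powi (int (dg n) - int (dg (n - 1)) - 2 - int e) * V * R0 * rest"
    if "r n \<noteq> 0" "n \<ge> 2" "Res (r n) (r (n - 1)) = (-1) ^ s * V * R0" for s V R0
    unfolding disc[OF that(1,2)] that(3) power_add by (simp only: mult_ac)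
  have ulas: "let eA = (\<lambda>u. ((u - 2) * k + j) * ((u - 1) * k + j + 1 + l));
                   sgn = (-1) ^ (dg n * (dg n + 2 * e - 1) div 2 + (\<Sum>u=2..n. eA u));
                   T = (if i + l < j + k then q j else (a 2 k * q j - v 2 * p i) / a 2 k)
               in
                 (\<forall>u\<ge>1. dg u = (u - 1) * k + j) \<and>
                 disc rc =
                   sgn * B0 ^ dg n
                   * L n powi (int (dg n) - int (dg (n - 1)) - 2 - int e)
                   * (\<Prod>u=2..n. to_ac (v u) ^ ((u - 2) * k + j)
                        * L (u - 1) ^ (if u = 2 then k + j - l - i else 2 * k - l)
                        * C (u - 1) ^ l)
                   * Res (r 1) (r (1 - 1)) * rest \<and>
                 disc rc =
                   sgn * B0 ^ dg n
                   * L n powi (int (dg n) - int (dg (n - 1)) - 2 - int e)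
                   * to_ac T ^ ((2 * k - l) * (n - 2))
                   * to_ac (q 0) ^ (l * (n - 1))
                   * to_ac (q j) ^ (k + j - l - i)
                   * (\<Prod>u=0..n - 2. to_ac (v (u + 2)) ^ (u * k + j))
                   * (\<Prod>s=1..n - 1. to_ac (a (s + 1) 0) ^ (l * (n - s - 1))
                        * to_ac (a (s + 1) k) ^ ((2 * k - l) * (n - s - 1)))
                   * Res (r 1) (r (1 - 1)) * rest"
    if U: "ulas_seq i j k l p q a v r" and n: "n \<ge> 2" for i j k l p q a v
  proof -
    define T where "T = (if i + l < j + k then q j else (a 2 k * q j - v 2 * p i) / a 2 k)"
    define V where "V = (\<Prod>u=2..n. to_ac (v u) ^ ((u - 2) * k + j)
        * L (u - 1) ^ (if u = 2 then k + j - l - i else 2 * k - l) * C (u - 1) ^ l)"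
    define s where "s = (\<Sum>u=2..n. ((u - 2) * k + j) * ((u - 1) * k + j + 1 + l))"
    have deg: "\<forall>u\<ge>1. dg u = (u - 1) * k + j"
      by (simp add: dg_def ulas_degree[OF U] ulas_deg_def)
    have Res: "Res (r n) (r (n - 1)) = (-1) ^ s * V * Res (r 1) (r (1 - 1))"
      unfolding s_def V_def L_def C_def diff_self_eq_0 by (rule ulas_Res[OF U n])
    note first = disc_by_Res[OF ulas_nonzero[OF U] n Res]
    have V: "V = to_ac T ^ ((2 * k - l) * (n - 2)) * to_ac (q 0) ^ (l * (n - 1))
        * to_ac (q j) ^ (k + j - l - i) * (\<Prod>u=0..n - 2. to_ac (v (u + 2)) ^ (u * k + j))
        * (\<Prod>s=1..n - 1. to_ac (a (s + 1) 0) ^ (l * (n - s - 1))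
             * to_ac (a (s + 1) k) ^ ((2 * k - l) * (n - s - 1)))"
      unfolding V_def L_def C_def T_def by (rule ulas_Res_factor[OF U n])
    have second: "disc rc = (-1) ^ (dg n * (dg n + 2 * e - 1) div 2 + s) * B0 ^ dg n
        * L n powi (int (dg n) - int (dg (n - 1)) - 2 - int e)
        * to_ac T ^ ((2 * k - l) * (n - 2)) * to_ac (q 0) ^ (l * (n - 1))
        * to_ac (q j) ^ (k + j - l - i) * (\<Prod>u=0..n - 2. to_ac (v (u + 2)) ^ (u * k + j))
        * (\<Prod>s=1..n - 1. to_ac (a (s + 1) 0) ^ (l * (n - s - 1))
             * to_ac (a (s + 1) k) ^ ((2 * k - l) * (n - s - 1)))
        * Res (r 1) (r (1 - 1)) * rest"
      unfolding first V by (simp only: mult_ac)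
    show ?thesis
      unfolding Let_def T_def[symmetric] s_def[symmetric] V_def[symmetric]
      by (intro conjI deg first second)
  qed
  have turaj: "let eA = (\<lambda>s. (dg s + l) * dg (s - 1));
                   \<gamma> = (\<lambda>s. int (dg s) - int m * int (dg (s - 2)) - int l)
               in
                 (\<forall>u\<ge>d. dg u = k * (\<Sum>s<u - d. m ^ s) + i d * m ^ (u - d)) \<and>
                 \<gamma> (d + 1) = int k - int l + int m * (int (i d) - int (i (d - 1))) \<and>
                 (\<forall>s\<ge>d + 2. \<gamma> s = int m ^ (s - d - 1) * (int k + int (i d) * (int m - 1))
                                     + int k - int l) \<and>
                 disc rc =
                   (-1) ^ (dg n * (dg n + 2 * e - 1) div 2 + (\<Sum>s=d + 1..n. m ^ (n - s) * eA s))
                   * B0 ^ dg n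
                   * L n powi (int (dg n) - int (dg (n - 1)) - 2 - int e)
                   * (\<Prod>s=d + 1..n. (L (s - 1) powi \<gamma> s * to_ac (v s) ^ dg (s - 1)
                        * C (s - 1) ^ l) ^ (m ^ (n - s)))
                   * Res (r d) (r (d - 1)) ^ (m ^ (n - d)) * rest"
    if T: "turaj_seq d i k l m p a t v r" and n: "n \<ge> d + 1"
    for d i k l m and p a :: "nat \<Rightarrow> nat \<Rightarrow> 'a" and t v
  proof -
    have "n \<ge> 2" "n \<ge> d"
      using n turaj_seqD(1)[OF T] by simp_all
    note res = disc_by_Res[OF turaj_nonzero[OF T] \<open>n \<ge> 2\<close> turaj_Res[OF T \<open>n \<ge> d\<close>]]
    have deg: "dg u = k * (\<Sum>s<u - d. m ^ s) + i d * m ^ (u - d)" if "u \<ge> d" for u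
      using that by (simp add: dg_def turaj_degree[OF T] turaj_deg_def)
    show ?thesis
      unfolding Let_def L_def C_def dg_def
      by (intro conjI allI impI turaj_degree_gap[OF T] deg[unfolded dg_def] res[unfolded L_def C_def dg_def])
  qed
  show ?thesis
    using ulas turaj unfolding Let_def L_def C_def dg_def B0_def rest_def by blast
qed

end
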